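(* Let $f:\mathbb{R}^n\to\mathbb{R}$ be a $C^{1,1}$ function, and for $r>0$ let $B(0,r)$ denote the closed ball of radius $r$ centered at the origin of $\mathbb{R}^n$. Let $R>0$. If $0\in f(\mathbb{R}^n)$ is a regular value of $f$ and $f^{-1}\{0\}\subset B(0,R)$, then $$\lim_{k\to\infty}\left\{\frac{1}{k}\int_{B(0,2R)}\left(\frac{\|Df(x)\|}{|f(x)|}\right)^{\frac{k-1}{k}}dx\right\}=2\,\mathcal{H}^{n-1}\big(\{x\in\mathbb{R}^n \mid f(x)=0\}\big).$$
   Context: A function $f:\mathbb{R}^n\to\mathbb{R}$ is $C^{1,1}$ if it is differentiable and its derivative $Df$ is Lipschitz continuous, i.e. there is $L\ge 0$ with $\|Df(v)-Df(x)\|\le L|v-x|$ for all $x,v\in\mathbb{R}^n$. The value $c\in\mathbb{R}$ is a regular value of $f$ if the differential $Df(x)$ is surjective (equivalently here, $Df(x)\neq 0$) at every $x\in f^{-1}\{c\}$. $\|\cdot\|$ is the operator norm (so $\|Df(x)\|$ equals the Euclidean norm of the gradient of $f$ at $x$), and $|\cdot|$ is the Euclidean norm. $dx$ is Lebesgue measure on $\mathbb{R}^n$; the integrand is defined off the zero set of $f$. $\mathcal{H}^{n-1}$ is $(n-1)$-dimensional Hausdorff measure on $\mathbb{R}^n$, normalized as follows: for $A\subset\mathbb{R}^n$, $\mathcal{H}^m(A)=\lim_{d\downarrow 0}\inf\sum_i \alpha(m)\left(\frac{\operatorname{diam}E_i}{2}\right)^m$, where the infimum is over countable covers $\{E_i\}$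 of $A$ with $\operatorname{diam}E_i\le d$ and $\alpha(m)$ is the volume of the unit $m$-ball ($\mathcal{H}^0$ is counting measure). The limit is over positive integers $k$. *)

theory Defs
  imports "HOL-Analysis.Analysis"
begin

definition C11 :: "('a::euclidean_space \<Rightarrow> real) \<Rightarrow> bool" where
  "C11 f \<longleftrightarrow> (\<forall>x. f differentiable (at x)) \<and>
     (\<exists>L\<ge>0. \<forall>v x. onorm (\<lambda>h. frechet_derivative f (at v) h - frechet_derivative f (at x) h)
                    \<le> L * norm (v - x))"

definition regular_value :: "('a::euclidean_space \<Rightarrow> real) \<Rightarrow> real \<Rightarrow> bool" where
  "regular_value f c \<longleftrightarrow>
     (\<forall>x \<in> f -` {c}. f differentiable (at x) \<and> surj (frechet_derivative f (at x)))"

text \<open>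
  The empty set gets size \<open>0\<close> explicitly: it pads finite covers to sequences, and for \<open>m = 0\<close>
  the power \<open>0 ^ 0 = 1\<close> would otherwise charge it, so that \<open>\<H>\<^sup>0\<close> would not be counting measure.
\<close>

definition hausdorff_size :: "nat \<Rightarrow> 'a::metric_space set \<Rightarrow> ennreal" where
  "hausdorff_size m E =
     (if E = {} then 0 else ennreal (unit_ball_vol (real m) * (diameter E / 2) ^ m))"

text \<open>
  Boundedness is required of the covering sets because the real-valued \<^const>\<open>diameter\<close> is
  unspecified on unbounded sets.
\<close>

definition hausdorff_covers :: "real \<Rightarrow> 'a::metric_space set \<Rightarrow> (nat \<Rightarrow> 'a set) set" where
  "hausdorff_covers d A =
     {E. A \<subseteq> (\<Union>i. E i) \<and> (\<forall>i. bounded (E i) \<and> diameter (E i) \<le> d)}"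

definition hausdorff_content :: "nat \<Rightarrow> real \<Rightarrow> 'a::metric_space set \<Rightarrow> ennreal" where
  "hausdorff_content m d A = (INF E \<in> hausdorff_covers d A. \<Sum>i. hausdorff_size m (E i))"

definition hausdorff_measure :: "nat \<Rightarrow> 'a::metric_space set \<Rightarrow> ennreal" where
  "hausdorff_measure m A = Lim (at_right 0) (\<lambda>d. hausdorff_content m d A)"

text \<open>The limit in this definition always exists, by monotonicity in \<open>d\<close>.\<close>

lemma hausdorff_content_antimono:
  assumes "d \<le> e"
  shows "hausdorff_content m e A \<le> hausdorff_content m d A"
  unfolding hausdorff_content_def hausdorff_covers_def
proof (rule INF_superset_mono[OF _ order_refl], rule subsetI)
  fix E assume "E \<in> {E. A \<subseteq> (\<Union>i. E i) \<and> (\<forall>i. bounded (E i) \<and> diameter (E i) \<le> d)}"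
  then show "E \<in> {E. A \<subseteq> (\<Union>i. E i) \<and> (\<forall>i. bounded (E i) \<and> diameter (E i) \<le> e)}"
    by (auto intro: order_trans[OF _ assms])
qed

lemma hausdorff_content_tendsto_SUP:
  "((\<lambda>d. hausdorff_content m d A) \<longlongrightarrow> (SUP d\<in>{0<..}. hausdorff_content m d A)) (at_right 0)"
proof (rule order_tendstoI)
  fix a assume "a < (SUP d\<in>{0<..}. hausdorff_content m d A)"
  then obtain d where d: "d > 0" "a < hausdorff_content m d A"
    by (auto simp: less_SUP_iff)
  have "eventually (\<lambda>e. e < d) (at_right 0)"
    using d(1) by (auto simp: eventually_at_right_field)
  then show "eventually (\<lambda>e. a < hausdorff_content m e A) (at_right 0)"
    by eventually_elim (rule less_le_trans[OF d(2) hausdorff_content_antimono[OF less_imp_le]])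
next
  fix a assume a: "(SUP d\<in>{0<..}. hausdorff_content m d A) < a"
  have "eventually (\<lambda>e::real. e > 0) (at_right 0)"
    by (rule eventually_at_right_less)
  then show "eventually (\<lambda>e. hausdorff_content m e A < a) (at_right 0)"
  proof eventually_elim
    case (elim e)
    then have "hausdorff_content m e A \<le> (SUP d\<in>{0<..}. hausdorff_content m d A)"
      by (intro SUP_upper) simp
    then show ?case using a by (rule le_less_trans)
  qed
qed

lemma hausdorff_measure_eq_SUP:
  "hausdorff_measure m A = (SUP d\<in>{0<..}. hausdorff_content m d A)"
  unfolding hausdorff_measure_def
  by (rule tendsto_Lim[OF _ hausdorff_content_tendsto_SUP]) simp

lemma hausdorff_content_tendsto:
  "((\<lambda>d. hausdorff_content m d A) \<longlongrightarrow> hausdorff_measure m A) (at_right 0)"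
  using hausdorff_content_tendsto_SUP by (simp add: hausdorff_measure_eq_SUP)

end

theory Submission
  imports Defs
begin

text \<open>
  Let \<open>M s\<close> be the integral of \<open>\<bar>\<nabla>f\<bar>\<close> over the layer \<open>{0 < \<bar>f\<bar> \<le> s}\<close> inside \<open>B(0, 2R)\<close>. Writing
  \<open>\<bar>f\<bar> powr -p\<close> as a superposition of indicators of layers turns the claim into \<open>M s / (2 s) \<rightarrow> \<H>(Z)\<close>
  as \<open>s \<rightarrow> 0\<close>, where \<open>Z\<close> is the zero set, so that no coarea formula is needed.

  Near \<open>z \<in> Z\<close> the gradient is almost constant, hence a line in direction \<open>\<nu> = \<nabla>f(z) / \<bar>\<nabla>f(z)\<bar>\<close> meets
  the layer in length about \<open>2 s / \<bar>\<nabla>f(z)\<bar>\<close>. By Fubini and the isodiametric inequality in the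
  hyperplane orthogonal to \<open>\<nu>\<close>, which follows from the Prekopa-Leindler inequality, the part of the
  layer in a small set of diameter \<open>D\<close> contributes at most about \<open>2 s \<alpha>(n-1) (D/2)^(n-1)\<close>, while the part
  in a small ball of radius \<open>r\<close> centred on \<open>Z\<close> contributes at least about \<open>2 s \<alpha>(n-1) r^(n-1)\<close>. Summing
  the first estimate over a nearly optimal cover of \<open>Z\<close> bounds \<open>limsup M s / (2 s)\<close> by \<open>\<H>(Z)\<close>; summing
  the second one over a disjoint Vitali family bounds \<open>\<H>(Z)\<close> by \<open>liminf M s / (2 s)\<close>.
\<close>

section \<open>The Prekopa-Leindler and isodiametric inequalities\<close>

text \<open>With \<open>G\<close> the gradient, the exponent \<open>p = (k - 1) / k\<close> splits
  the integrand into \<open>norm (G x) * \<bar>f x\<bar> powr - p\<close> and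
  \<open>norm (G x) powr - (1 / k)\<close>. Near the zero set the second factor is squeezed between
  \<open>1 / k\<close>-th powers of positive constants, which tend to 1; away from it the integrand
  stays bounded and the prefactor \<open>1 / k\<close> kills it. In the model case where a layer has
  mass \<open>2 * s * c\<close>, the superposition equals
  \<open>2 * c * \<delta> powr (1 / k) * k\<close>, so the prefactor leaves \<open>2 * c\<close> in
  the limit.

  The weight \<bar>\<nabla>f\<bar> cancels the factor 1 / \<bar>\<nabla>f\<bar> in the length of a
  fibre, so the local bounds are uniform along the zero set and add up to sums of Hausdorff sizes.
  The two halves are not symmetric: the sets of a cover have any shape, and the isodiametric
  inequality is what relates their projections to their diameters, while balls centred on the zero
  set only call for the volume of a ball in the hyperplane.\<close>

lemma emeasure_lborel_real_affine:
  fixes A :: "real set"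
  assumes [measurable]: "A \<in> sets borel" and c: "c \<noteq> 0"
  shows "emeasure lborel A = ennreal \<bar>c\<bar> * emeasure lborel {x. t + c * x \<in> A}"
proof -
  have "(\<integral>\<^sup>+x. indicator A x \<partial>lborel) = ennreal \<bar>c\<bar> * (\<integral>\<^sup>+x. indicator A (t + c * x) \<partial>lborel)"
    by (rule nn_integral_real_affine) (use c in auto)
  also have "(\<lambda>x. indicator A (t + c * x) :: ennreal) = indicator {x. t + c * x \<in> A}"
    by (auto simp: indicator_def)
  also have "(\<integral>\<^sup>+x. indicator {x. t + c * x \<in> A} x \<partial>lborel) = emeasure lborel {x. t + c * x \<in> A}"
    by (rule nn_integral_indicator) measurable
  finally show ?thesis by simp
qed

text \<open>
  The Brunn-Minkowski and Prekopa-Leindler inequalities are stated for differences instead of midpoints: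
  this is the form that the isodiametric inequality uses, and no reflection is needed. It costs a
  factor of 4 per dimension in the latter.
\<close>

lemma brunn_minkowski_1d_bounded:
  fixes A B C :: "real set"
  assumes [measurable]: "A \<in> sets borel" "B \<in> sets borel" "C \<in> sets borel"
    and ne: "A \<noteq> {}" "B \<noteq> {}" and bnd: "bounded A" "bounded B"
    and sub: "\<And>x y. x \<in> A \<Longrightarrow> y \<in> B \<Longrightarrow> x - y \<in> C"
  shows "emeasure lborel A + emeasure lborel B \<le> emeasure lborel C"
proof (rule ennreal_le_epsilon)
  fix e :: real assume e: "0 < e"
  have bA: "bdd_above A" and bB: "bdd_above B"
    using bnd bounded_imp_bdd_above by auto
  obtain a where a: "a \<in> A" "Sup A - e/2 < a"
    using less_cSup_iff[OF ne(1) bA, of "Sup A - e/2"] e by auto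
  obtain b where b: "b \<in> B" "Sup B - e/2 < b"
    using less_cSup_iff[OF ne(2) bB, of "Sup B - e/2"] e by auto
  \<comment> \<open>\<open>?A\<close> is \<open>A\<close> shifted by \<open>- b\<close>, and
    \<open>?B\<close> is \<open>B\<close> reflected and shifted by \<open>a\<close>. The first ends
    at \<open>Sup A - b\<close>, the second begins at \<open>a - Sup B\<close>. Suprema need not be
    attained, so the two sets may overlap, but in length at most \<open>e\<close>.\<close>
  let ?A = "{x. b + 1 * x \<in> A}" and ?B = "{x. a + (-1) * x \<in> B}"
  have mA [measurable]: "?A \<in> sets borel" and mB [measurable]: "?B \<in> sets borel"
    by measurable
  have eA: "emeasure lborel A = emeasure lborel ?A"
    using emeasure_lborel_real_affine[OF assms(1), of 1 b] by simp
  have eB: "emeasure lborel B = emeasure lborel ?B"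
    using emeasure_lborel_real_affine[OF assms(2), of "-1" a] by simp
  have "?A \<inter> ?B \<subseteq> {a - Sup B .. Sup A - b}"
    using cSup_upper[OF _ bA] cSup_upper[OF _ bB] by force
  then have "emeasure lborel (?A \<inter> ?B) \<le> emeasure lborel {a - Sup B .. Sup A - b}"
    by (rule emeasure_mono) simp
  also have "\<dots> \<le> ennreal e"
    using a b e cSup_upper[OF a(1) bA] cSup_upper[OF b(1) bB] by (auto intro!: ennreal_leI)
  finally have i: "emeasure lborel (?A \<inter> ?B) \<le> ennreal e" .
  have AB: "?A \<union> ?B \<subseteq> C"
  proof safe
    fix x assume "b + 1 * x \<in> A" then show "x \<in> C" using sub[OF _ b(1)] by force
  next
    fix x assume "a + - 1 * x \<in> B" then show "x \<in> C" using sub[OF a(1)] by force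
  qed
  have "emeasure lborel ?A + emeasure lborel ?B
      = emeasure lborel (?A \<union> ?B) + emeasure lborel (?A \<inter> ?B)"
    by (rule emeasure_Un_Int) auto
  also have "\<dots> \<le> emeasure lborel C + ennreal e"
    using AB i by (intro add_mono emeasure_mono) auto
  finally show "emeasure lborel A + emeasure lborel B \<le> emeasure lborel C + ennreal e"
    unfolding eA eB .
qed

text \<open>Exhaustion by intervals. The inequality fails for an empty factor, so the truncations
  are used only once they contain \<open>a\<close> and \<open>b\<close>.\<close>

lemma brunn_minkowski_1d:
  fixes A B C :: "real set"
  assumes [measurable]: "A \<in> sets borel" "B \<in> sets borel" "C \<in> sets borel"
    and ne: "A \<noteq> {}" "B \<noteq> {}"
    and sub: "\<And>x y. x \<in> A \<Longrightarrow> y \<in> B \<Longrightarrow> x - y \<in> C"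
  shows "emeasure lborel A + emeasure lborel B \<le> emeasure lborel C"
proof -
  obtain a b where ab: "a \<in> A" "b \<in> B" using ne by auto
  let ?I = "\<lambda>n::nat. {- real n .. real n}"
  have lim: "(\<lambda>n. emeasure lborel (S \<inter> ?I n)) \<longlonglongrightarrow> emeasure lborel S"
    if [measurable]: "S \<in> sets borel" for S
  proof -
    have "(\<lambda>n. emeasure lborel (S \<inter> ?I n)) \<longlonglongrightarrow> emeasure lborel (\<Union>n. S \<inter> ?I n)"
      by (rule Lim_emeasure_incseq) (auto simp: incseq_def)
    also have "(\<Union>n. S \<inter> ?I n) = S"
    proof (intro equalityI subsetI)
      fix x assume x: "x \<in> S"
      obtain n where "\<bar>x\<bar> \<le> real n" using real_arch_simple by blast
      then show "x \<in> (\<Union>n. S \<inter> ?I n)" using x by (auto intro!: exI[of _ n])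
    qed auto
    finally show ?thesis .
  qed
  have "(\<lambda>n. emeasure lborel (A \<inter> ?I n) + emeasure lborel (B \<inter> ?I n))
      \<longlonglongrightarrow> emeasure lborel A + emeasure lborel B"
    by (intro tendsto_add lim) auto
  moreover
  obtain N where N: "max \<bar>a\<bar> \<bar>b\<bar> \<le> real N" using real_arch_simple by blast
  have "emeasure lborel (A \<inter> ?I n) + emeasure lborel (B \<inter> ?I n) \<le> emeasure lborel C"
    if "N \<le> n" for n
  proof (rule brunn_minkowski_1d_bounded)
    have "real N \<le> real n" using that by simp
    then have "max \<bar>a\<bar> \<bar>b\<bar> \<le> real n" using N by linarith
    then have "a \<in> A \<inter> ?I n" "b \<in> B \<inter> ?I n" using ab by (auto simp: abs_le_iff)
    then show "A \<inter> ?I n \<noteq> {}" "B \<inter> ?I n \<noteq> {}" by blast+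
    show "bounded (A \<inter> ?I n)" "bounded (B \<inter> ?I n)"
      by (auto intro: bounded_subset[OF bounded_closed_interval])
  qed (use sub in auto)
  ultimately show ?thesis
    by (intro LIMSEQ_le_const2) auto
qed

text \<open>Fubini for the region under the graph; a value \<open>top\<close> corresponds to a
  half-line of infinite length.\<close>

lemma nn_integral_layer_cake:
  assumes "sigma_finite_measure M" and [measurable]: "f \<in> borel_measurable M"
  shows "(\<integral>\<^sup>+x. f x \<partial>M)
    = (\<integral>\<^sup>+t. indicator {0..} t * emeasure M {x\<in>space M. ennreal t < f x} \<partial>lborel)"
proof -
  interpret pair_sigma_finite lborel M
    using assms(1) by (simp add: pair_sigma_finite_def lborel.sigma_finite_measure_axioms)
  have 1: "(\<integral>\<^sup>+t. indicator {t. 0 \<le> t \<and> ennreal t < y} t \<partial>lborel) = y" for y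
  proof (cases y)
    case (real r)
    then have "{t. 0 \<le> t \<and> ennreal t < y} = {0..<r}"
      by (auto simp: ennreal_less_iff)
    then show ?thesis using real by simp
  next
    case top
    then have "{t. 0 \<le> t \<and> ennreal t < y} = {0::real..}" by auto
    moreover have "emeasure lborel {0::real..} = top"
    proof (rule ccontr)
      assume "emeasure lborel {0::real..} \<noteq> top"
      then obtain r where r: "emeasure lborel {0::real..} = ennreal r" "0 \<le> r"
        by (cases "emeasure lborel {0::real..}") auto
      have "emeasure lborel {0 .. r + 1} \<le> emeasure lborel {0::real..}"
        by (rule emeasure_mono) auto
      then show False using r by simp
    qed
    ultimately show ?thesis using top by simp
  qed
  have "(\<integral>\<^sup>+x. f x \<partial>M) = (\<integral>\<^sup>+x. \<integral>\<^sup>+t. indicator {t. 0 \<le> t \<and> ennreal t < f x} t \<partial>lborel \<partial>M)"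
    by (simp only: 1)
  also have "\<dots> = (\<integral>\<^sup>+t. \<integral>\<^sup>+x. indicator {t. 0 \<le> t \<and> ennreal t < f x} t \<partial>M \<partial>lborel)"
    by (rule Fubini') simp
  also have "\<dots> = (\<integral>\<^sup>+t. indicator {0..} t * emeasure M {x\<in>space M. ennreal t < f x} \<partial>lborel)"
  proof (intro nn_integral_cong)
    fix t :: real
    have "(\<integral>\<^sup>+x. indicator {t. 0 \<le> t \<and> ennreal t < f x} t \<partial>M)
       = (\<integral>\<^sup>+x. indicator {0..} t * indicator {x\<in>space M. ennreal t < f x} x \<partial>M)"
      by (intro nn_integral_cong) (auto simp: indicator_def)
    also have "\<dots> = indicator {0..} t * emeasure M {x\<in>space M. ennreal t < f x}"
      by (subst nn_integral_cmult) auto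
    finally show "(\<integral>\<^sup>+x. indicator {t. 0 \<le> t \<and> ennreal t < f x} t \<partial>M)
       = indicator {0..} t * emeasure M {x\<in>space M. ennreal t < f x}" .
  qed
  finally show ?thesis .
qed

text \<open>When both suprema are 1, the superlevel sets of \<open>f\<close> and \<open>g\<close>
  are nonempty at the same levels \<open>t < 1\<close>, so the Brunn-Minkowski inequality applies at
  each of them and can be integrated over \<open>t\<close>. The result bounds the sum of the
  integrals, which is stronger than a bound on their product.\<close>

lemma prekopa_leindler_1d_normalized:
  fixes f g h :: "real \<Rightarrow> ennreal"
  assumes [measurable]: "f \<in> borel_measurable borel" "g \<in> borel_measurable borel"
      "h \<in> borel_measurable borel"
    and f1: "\<And>x. f x \<le> 1" and g1: "\<And>x. g x \<le> 1"
    and fs: "\<And>t. 0 \<le> t \<Longrightarrow> t < 1 \<Longrightarrow> \<exists>x. ennreal t < f x"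
    and gs: "\<And>t. 0 \<le> t \<Longrightarrow> t < 1 \<Longrightarrow> \<exists>x. ennreal t < g x"
    and le: "\<And>x y. f x * g y \<le> (h (x - y))\<^sup>2"
  shows "(\<integral>\<^sup>+x. f x \<partial>lborel) + (\<integral>\<^sup>+x. g x \<partial>lborel) \<le> (\<integral>\<^sup>+x. h x \<partial>lborel)"
proof -
  let ?E = "\<lambda>f t. indicator {0..} t * emeasure lborel {x\<in>space lborel. ennreal t < f x}"
  have layer: "(\<integral>\<^sup>+x. f x \<partial>lborel) = (\<integral>\<^sup>+t. ?E f t \<partial>lborel)"
    if [measurable]: "f \<in> borel_measurable borel" for f :: "real \<Rightarrow> ennreal"
    by (rule nn_integral_layer_cake) (auto intro: lborel.sigma_finite_measure_axioms)
  have meas: "?E f \<in> borel_measurable lborel"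
    if [measurable]: "f \<in> borel_measurable borel" for f :: "real \<Rightarrow> ennreal"
    by measurable
  have pt: "?E f t + ?E g t \<le> ?E h t" for t
  proof (cases "0 \<le> t \<and> t < 1")
    case True
    have "emeasure lborel {x. ennreal t < f x} + emeasure lborel {x. ennreal t < g x}
        \<le> emeasure lborel {x. ennreal t < h x}"
    proof (rule brunn_minkowski_1d)
      fix x y assume "x \<in> {x. ennreal t < f x}" "y \<in> {x. ennreal t < g x}"
      then have xy: "ennreal t < f x" "ennreal t < g y" by auto
      have fin: "f x < top" "g y < top"
        using f1[of x] g1[of y] by (auto intro: le_less_trans[OF _ ennreal_one_less_top])
      obtain p q where pq: "f x = ennreal p" "g y = ennreal q" "0 \<le> p" "0 \<le> q"
        using fin by (cases "f x"; cases "g y") auto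
      have "t * t < p * q"
        using xy True pq by (intro mult_strict_mono) (auto simp: ennreal_less_iff)
      then have "ennreal (t * t) < f x * g y"
        using pq True by (simp add: ennreal_mult[symmetric] ennreal_less_iff)
      also have "\<dots> \<le> (h (x - y))\<^sup>2" by (rule le)
      finally have *: "ennreal t * ennreal t < (h (x - y))\<^sup>2" using True by (simp add: ennreal_mult)
      have "ennreal t < h (x - y)"
      proof (rule ccontr)
        assume "\<not> ennreal t < h (x - y)"
        then have "h (x - y) * h (x - y) \<le> ennreal t * ennreal t" by (intro mult_mono) auto
        then show False using * by (auto simp: power2_eq_square)
      qed
      then show "x - y \<in> {x. ennreal t < h x}" by simp
    qed (use fs[of t] gs[of t] True in auto)
    then show ?thesis using True by simp
  next
    case False
    show ?thesis
    proof (cases "0 \<le> t")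
      case True
      then have "1 \<le> ennreal t" using False by simp
      then have "f x \<le> ennreal t" "g x \<le> ennreal t" for x
        using f1[of x] g1[of x] by (blast intro: order_trans)+
      then have "{x. ennreal t < f x} = {}" "{x. ennreal t < g x} = {}"
        by (simp_all add: not_less)
      then show ?thesis by simp
    qed simp
  qed
  have "(\<integral>\<^sup>+x. f x \<partial>lborel) + (\<integral>\<^sup>+x. g x \<partial>lborel) = (\<integral>\<^sup>+t. ?E f t + ?E g t \<partial>lborel)"
    unfolding layer[OF assms(1)] layer[OF assms(2)]
    by (rule nn_integral_add[symmetric]) (auto intro!: meas)
  also have "\<dots> \<le> (\<integral>\<^sup>+t. ?E h t \<partial>lborel)"
    by (intro nn_integral_mono pt)
  also have "\<dots> = (\<integral>\<^sup>+x. h x \<partial>lborel)"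
    by (rule layer[symmetric]) measurable
  finally show ?thesis .
qed

text \<open>The inequality of arithmetic and geometric means, by which the bound on the sum of the
  normalized integrals becomes one on their product. The factor 4 originates here.\<close>

lemma ennreal_four_mult_le: "4 * (x * y) \<le> (x + y)\<^sup>2" for x y :: ennreal
proof (cases "x = top \<or> y = top")
  case True
  then show ?thesis by (auto simp: power2_eq_square)
next
  case False
  then obtain p q where pq: "x = ennreal p" "y = ennreal q" "0 \<le> p" "0 \<le> q"
    by (cases x; cases y) auto
  have "4 * (p * q) \<le> (p + q)\<^sup>2"
    using zero_le_power2[of "p - q"] by (simp add: power2_eq_square algebra_simps)
  then show ?thesis
    using pq by (simp add: ennreal_power ennreal_leI flip: ennreal_plus ennreal_mult ennreal_numeral)
qed

text \<open>Homogeneity: dividing \<open>f\<close> and \<open>g\<close> by their suprema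
  \<open>a\<close> and \<open>b\<close>, and \<open>h\<close> by \<open>sqrt (a * b)\<close>,
  preserves the hypothesis and makes both suprema 1. The bounds by natural numbers make the suprema
  finite.\<close>

lemma prekopa_leindler_1d_bounded:
  fixes f g h :: "real \<Rightarrow> ennreal"
  assumes [measurable]: "f \<in> borel_measurable borel" "g \<in> borel_measurable borel"
      "h \<in> borel_measurable borel"
    and fb: "\<And>x. f x \<le> of_nat m" and gb: "\<And>x. g x \<le> of_nat n"
    and le: "\<And>x y. f x * g y \<le> (h (x - y))\<^sup>2"
  shows "4 * ((\<integral>\<^sup>+x. f x \<partial>lborel) * (\<integral>\<^sup>+x. g x \<partial>lborel)) \<le> (\<integral>\<^sup>+x. h x \<partial>lborel)\<^sup>2"
proof (cases "(SUP x. f x) = 0 \<or> (SUP x. g x) = 0")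
  case True
  then have "(\<forall>x. f x = 0) \<or> (\<forall>x. g x = 0)"
    by (auto simp: bot_ennreal[symmetric] SUP_bot_conv)
  then show ?thesis by auto
next
  case False
  have "(SUP x. f x) \<le> of_nat m" "(SUP x. g x) \<le> of_nat n"
    by (auto intro: SUP_least fb gb)
  then have "(SUP x. f x) < top" "(SUP x. g x) < top"
    by (auto intro: le_less_trans simp: of_nat_less_top)
  then obtain a b where ab: "(SUP x. f x) = ennreal a" "(SUP x. g x) = ennreal b" "0 \<le> a" "0 \<le> b"
    by (cases "SUP x. f x"; cases "SUP x. g x") auto
  then have pos: "0 < a" "0 < b" using False by (auto simp: less_le)
  define c where "c = sqrt (a * b)"
  have c: "0 < c" "c * c = a * b" using pos by (auto simp: c_def)
  have le_sup: "f x \<le> ennreal a" "g x \<le> ennreal b" for x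
    unfolding ab(1,2)[symmetric] by (auto intro: SUP_upper)
  have scale: "\<exists>x. ennreal t < u x / ennreal d"
    if "0 \<le> t" "t < 1" "(SUP x. u x) = ennreal d" "0 < d" for t d and u :: "real \<Rightarrow> ennreal"
  proof -
    have "ennreal (t * d) < (SUP x. u x)" using that by (simp add: ennreal_less_iff)
    then obtain x where "ennreal (t * d) < u x" by (auto simp: less_SUP_iff)
    then have "ennreal t < u x / ennreal d"
      using that by (cases "u x")
        (auto simp: ennreal_less_iff divide_ennreal field_simps ennreal_top_divide)
    then show ?thesis by blast
  qed
  let ?f = "\<lambda>x. f x / ennreal a" and ?g = "\<lambda>x. g x / ennreal b" and ?h = "\<lambda>x. h x / ennreal c"
  let ?X = "(\<integral>\<^sup>+x. f x \<partial>lborel) / ennreal a" and ?Y = "(\<integral>\<^sup>+x. g x \<partial>lborel) / ennreal b"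
  have one: "u / ennreal d \<le> 1" if "u \<le> ennreal d" "0 < d" for u d
    using divide_right_mono_ennreal[OF that(1), of "ennreal d"] that(2)
    by (simp add: ennreal_divide_self)
  have cc: "ennreal c * ennreal c = ennreal a * ennreal b"
    using c pos by (simp add: ennreal_mult[symmetric])
  have "(\<integral>\<^sup>+x. ?f x \<partial>lborel) + (\<integral>\<^sup>+x. ?g x \<partial>lborel) \<le> (\<integral>\<^sup>+x. ?h x \<partial>lborel)"
  proof (rule prekopa_leindler_1d_normalized)
    fix x y
    have "?f x * ?g y = f x * g y / (ennreal a * ennreal b)"
      using pos by (simp add: divide_ennreal_def ennreal_inverse_mult mult_ac)
    also have "\<dots> \<le> (h (x - y))\<^sup>2 / (ennreal a * ennreal b)"
      by (intro divide_right_mono_ennreal le)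
    also have "\<dots> = (?h (x - y))\<^sup>2"
      unfolding cc[symmetric] using c
      by (simp add: divide_ennreal_def ennreal_inverse_mult mult_ac power2_eq_square)
    finally show "?f x * ?g y \<le> (?h (x - y))\<^sup>2" .
  qed (use le_sup one pos scale ab in auto)
  then have XY: "?X + ?Y \<le> (\<integral>\<^sup>+x. h x \<partial>lborel) / ennreal c"
    by (simp add: nn_integral_divide)
  have cancel: "ennreal d * (x / ennreal d) = x" if "0 < d" for d x
    using that
    by (simp add: ennreal_times_divide mult.commute[of "ennreal d"] ennreal_mult_divide_eq)
  have "4 * ((\<integral>\<^sup>+x. f x \<partial>lborel) * (\<integral>\<^sup>+x. g x \<partial>lborel))
      = 4 * ((ennreal a * ?X) * (ennreal b * ?Y))"
    using pos by (simp only: cancel)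
  also have "\<dots> = ennreal c * ennreal c * (4 * (?X * ?Y))"
    unfolding cc by (simp only: mult_ac)
  also have "\<dots> \<le> ennreal c * ennreal c * ((\<integral>\<^sup>+x. h x \<partial>lborel) / ennreal c)\<^sup>2"
    using XY by (intro mult_left_mono order_trans[OF ennreal_four_mult_le] power_mono) auto
  also have "\<dots> = (ennreal c * ((\<integral>\<^sup>+x. h x \<partial>lborel) / ennreal c))\<^sup>2"
    by (simp only: power2_eq_square mult_ac)
  also have "ennreal c * ((\<integral>\<^sup>+x. h x \<partial>lborel) / ennreal c) = (\<integral>\<^sup>+x. h x \<partial>lborel)"
    using c(1) by (rule cancel)
  finally show ?thesis .
qed

text \<open>Truncating \<open>f\<close> and \<open>g\<close> lowers the left side of the hypothesis
  and leaves \<open>h\<close> alone, so monotone convergence, in each function separately, removes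
  the bounds.\<close>

lemma prekopa_leindler_1d:
  fixes f g h :: "real \<Rightarrow> ennreal"
  assumes [measurable]: "f \<in> borel_measurable borel" "g \<in> borel_measurable borel"
      "h \<in> borel_measurable borel"
    and le: "\<And>x y. f x * g y \<le> (h (x - y))\<^sup>2"
  shows "4 * ((\<integral>\<^sup>+x. f x \<partial>lborel) * (\<integral>\<^sup>+x. g x \<partial>lborel)) \<le> (\<integral>\<^sup>+x. h x \<partial>lborel)\<^sup>2"
proof -
  let ?t = "\<lambda>f n x. min (f x) (of_nat n :: ennreal)"
  have trunc: "(\<integral>\<^sup>+x. f x \<partial>lborel) = (SUP n. \<integral>\<^sup>+x. ?t f n x \<partial>lborel)"
    if [measurable]: "f \<in> borel_measurable borel" for f :: "real \<Rightarrow> ennreal"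
  proof -
    have "f x = (SUP n. ?t f n x)" for x
    proof -
      have "(SUP n. ?t f n x) = min (f x) (SUP n. of_nat n)"
        unfolding inf_min[symmetric] by (simp add: inf_SUP)
      then show ?thesis by (simp add: ennreal_SUP_of_nat_eq_top)
    qed
    then have "(\<integral>\<^sup>+x. f x \<partial>lborel) = (\<integral>\<^sup>+x. (SUP n. ?t f n x) \<partial>lborel)" by simp
    also have "\<dots> = (SUP n. \<integral>\<^sup>+x. ?t f n x \<partial>lborel)"
      by (rule nn_integral_monotone_convergence_SUP)
        (auto simp: incseq_def le_fun_def intro: min.coboundedI2)
    finally show ?thesis .
  qed
  have b: "4 * ((\<integral>\<^sup>+x. ?t f m x \<partial>lborel) * (\<integral>\<^sup>+x. ?t g n x \<partial>lborel))
     \<le> (\<integral>\<^sup>+x. h x \<partial>lborel)\<^sup>2" for m n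
    by (rule prekopa_leindler_1d_bounded[of _ _ _ m n])
      (auto intro: order_trans[OF mult_mono le])
  show ?thesis
    unfolding trunc[OF assms(1)] trunc[OF assms(2)]
    by (simp add: SUP_mult_left_ennreal SUP_mult_right_ennreal SUP_le_iff b)
qed

text \<open>Induction on the coordinates. The slices of \<open>f\<close> at \<open>a\<close>, of
  \<open>g\<close> at \<open>b\<close> and of \<open>h\<close> at \<open>a - b\<close> satisfy the
  hypothesis in the lower dimension. What the induction yields for them is the one-dimensional
  hypothesis for the slice integrals, once the constant \<open>4 ^ card I\<close> is attached to
  that of \<open>f\<close>.\<close>

lemma prekopa_leindler_PiM:
  fixes f g h :: "('i \<Rightarrow> real) \<Rightarrow> ennreal"
  assumes "finite I"
    and "f \<in> borel_measurable (PiM I (\<lambda>_. lborel))" "g \<in> borel_measurable (PiM I (\<lambda>_. lborel))"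
      "h \<in> borel_measurable (PiM I (\<lambda>_. lborel))"
    and "\<And>x y. x \<in> space (PiM I (\<lambda>_. lborel)) \<Longrightarrow> y \<in> space (PiM I (\<lambda>_. lborel)) \<Longrightarrow>
        f x * g y \<le> (h (\<lambda>i\<in>I. x i - y i))\<^sup>2"
  shows "4 ^ card I * ((\<integral>\<^sup>+x. f x \<partial>PiM I (\<lambda>_. lborel)) * (\<integral>\<^sup>+x. g x \<partial>PiM I (\<lambda>_. lborel)))
      \<le> (\<integral>\<^sup>+x. h x \<partial>PiM I (\<lambda>_. lborel))\<^sup>2"
  using assms
proof (induction I arbitrary: f g h rule: finite_induct)
  case empty
  interpret product_sigma_finite "\<lambda>_::'i. lborel :: real measure" by standard
  have "(\<lambda>k. undefined) \<in> space (PiM {} (\<lambda>_::'i. lborel :: real measure))"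
    by (simp add: space_PiM)
  from empty.prems(4)[OF this this] show ?case
    by (simp add: nn_integral_empty restrict_def)
next
  case (insert i I)
  interpret product_sigma_finite "\<lambda>_::'i. lborel :: real measure" by standard
  interpret I: finite_product_sigma_finite "\<lambda>_::'i. lborel :: real measure" I
    by standard (rule insert.hyps)
  note [measurable] = insert.prems(1-3)
  let ?P = "PiM I (\<lambda>_::'i. lborel :: real measure)"
  let ?F = "\<lambda>f y. \<integral>\<^sup>+x. f (x(i := y)) \<partial>?P"
  have mF: "?F f \<in> borel_measurable borel"
    if [measurable]: "f \<in> borel_measurable (PiM (insert i I) (\<lambda>_. lborel))"
    for f :: "('i \<Rightarrow> real) \<Rightarrow> ennreal"
    by measurable
  have sl: "(\<lambda>x. f (x(i := y))) \<in> borel_measurable ?P"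
    if [measurable]: "f \<in> borel_measurable (PiM (insert i I) (\<lambda>_. lborel))"
    for f :: "('i \<Rightarrow> real) \<Rightarrow> ennreal" and y
    by measurable
  have eq: "(\<integral>\<^sup>+x. f x \<partial>PiM (insert i I) (\<lambda>_. lborel)) = (\<integral>\<^sup>+y. ?F f y \<partial>lborel)"
    if "f \<in> borel_measurable (PiM (insert i I) (\<lambda>_. lborel))"
    for f :: "('i \<Rightarrow> real) \<Rightarrow> ennreal"
    by (rule product_nn_integral_insert_rev[OF insert.hyps that])
  have "4 * ((\<integral>\<^sup>+y. 4 ^ card I * ?F f y \<partial>lborel) * (\<integral>\<^sup>+y. ?F g y \<partial>lborel))
      \<le> (\<integral>\<^sup>+y. ?F h y \<partial>lborel)\<^sup>2"
  proof (rule prekopa_leindler_1d)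
    fix a b :: real
    have "4 ^ card I * (?F f a * ?F g b) \<le> (?F h (a - b))\<^sup>2"
    proof (rule insert.IH)
      fix x y assume xy: "x \<in> space ?P" "y \<in> space ?P"
      have "f (x(i := a)) * g (y(i := b)) \<le> (h (\<lambda>j\<in>insert i I. (x(i := a)) j - (y(i := b)) j))\<^sup>2"
        using xy by (intro insert.prems(4)) (auto simp: space_PiM PiE_def extensional_def)
      also have "(\<lambda>j\<in>insert i I. (x(i := a)) j - (y(i := b)) j) = (\<lambda>j\<in>I. x j - y j)(i := a - b)"
        using insert.hyps by (auto simp: fun_eq_iff restrict_def)
      finally show "f (x(i := a)) * g (y(i := b)) \<le> (h ((\<lambda>j\<in>I. x j - y j)(i := a - b)))\<^sup>2" .
    qed (rule sl, rule insert.prems)+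
    then show "4 ^ card I * ?F f a * ?F g b \<le> (?F h (a - b))\<^sup>2"
      by (simp add: mult.assoc)
  qed (auto simp del: fun_upd_apply intro: mF insert.prems)
  also have "(\<integral>\<^sup>+y. 4 ^ card I * ?F f y \<partial>lborel) = 4 ^ card I * (\<integral>\<^sup>+y. ?F f y \<partial>lborel)"
    by (rule nn_integral_cmult) (simp add: mF[OF insert.prems(1)])
  finally have "4 * (4 ^ card I * (\<integral>\<^sup>+y. ?F f y \<partial>lborel) * (\<integral>\<^sup>+y. ?F g y \<partial>lborel))
      \<le> (\<integral>\<^sup>+y. ?F h y \<partial>lborel)\<^sup>2" .
  then show ?case
    unfolding eq[OF insert.prems(1)] eq[OF insert.prems(2)] eq[OF insert.prems(3)]
      card_insert_disjoint[OF insert.hyps] power_Suc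
    by (simp only: mult.assoc)
qed

text \<open>The inequality is applied to \<open>F\<close> twice and to \<open>c\<close> times the
  indicator of the ball of radius \<open>D\<close>, which contains all differences of points of the
  support. The square root of \<open>4 ^ card I\<close> turns the radius \<open>D\<close> into
  \<open>D / 2\<close>. The statement is about a function because it receives the fibre integrals of
  \<open>nn_integral_le_fibres\<close>.\<close>

lemma isodiametric_PiM:
  fixes F :: "('i \<Rightarrow> real) \<Rightarrow> ennreal"
  assumes I: "finite I" and [measurable]: "F \<in> borel_measurable (PiM I (\<lambda>_. lborel))"
    and c: "0 \<le> c" "\<And>x. x \<in> space (PiM I (\<lambda>_. lborel)) \<Longrightarrow> F x \<le> ennreal c"
    and D: "0 < D" "\<And>x y. x \<in> space (PiM I (\<lambda>_. lborel)) \<Longrightarrow> y \<in> space (PiM I (\<lambda>_. lborel)) \<Longrightarrow>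
        F x \<noteq> 0 \<Longrightarrow> F y \<noteq> 0 \<Longrightarrow> sqrt (\<Sum>i\<in>I. (x i - y i)\<^sup>2) \<le> D"
  shows "(\<integral>\<^sup>+x. F x \<partial>PiM I (\<lambda>_. lborel)) \<le> ennreal (c * (unit_ball_vol (real (card I)) * (D / 2) ^ card I))"
proof -
  let ?P = "PiM I (\<lambda>_::'i. lborel :: real measure)"
  let ?B = "{f. sqrt (\<Sum>i\<in>I. (f i)\<^sup>2) \<le> D} \<inter> space ?P"
  let ?v = "unit_ball_vol (real (card I))"
  have "?B = {f\<in>space ?P. sqrt (\<Sum>i\<in>I. (f i)\<^sup>2) \<le> D}" by auto
  also have "\<dots> \<in> sets ?P" by measurable
  finally have mB [measurable]: "?B \<in> sets ?P" .
  have "4 ^ card I * ((\<integral>\<^sup>+x. F x \<partial>?P) * (\<integral>\<^sup>+x. F x \<partial>?P)) \<le> (\<integral>\<^sup>+x. ennreal c * indicator ?B x \<partial>?P)\<^sup>2"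
  proof (rule prekopa_leindler_PiM[OF I])
    fix x y assume xy: "x \<in> space ?P" "y \<in> space ?P"
    show "F x * F y \<le> (ennreal c * indicator ?B (\<lambda>i\<in>I. x i - y i))\<^sup>2"
    proof (cases "F x = 0 \<or> F y = 0")
      case False
      have "(\<lambda>i\<in>I. x i - y i) \<in> ?B"
        using D(2)[OF xy] False by (auto simp: space_PiM)
      then show ?thesis
        using c(2)[OF xy(1)] c(2)[OF xy(2)] by (simp add: power2_eq_square mult_mono)
    qed auto
  qed auto
  also have "(\<integral>\<^sup>+x. ennreal c * indicator ?B x \<partial>?P) = ennreal c * emeasure ?P ?B"
    by (rule nn_integral_cmult_indicator) measurable
  also have "\<dots> = ennreal (c * (?v * D ^ card I))"
    using emeasure_cball_aux[OF I D(1)] c D by (simp add: ennreal_mult)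
  finally have le: "4 ^ card I * ((\<integral>\<^sup>+x. F x \<partial>?P) * (\<integral>\<^sup>+x. F x \<partial>?P))
      \<le> (ennreal (c * (?v * D ^ card I)))\<^sup>2" .
  show ?thesis
  proof (cases "\<integral>\<^sup>+x. F x \<partial>?P")
    case (real r)
    have nn: "0 \<le> c * (?v * D ^ card I)" using c D by auto
    have "(4::ennreal) ^ card I = ennreal (4 ^ card I)" by (simp flip: ennreal_power)
    then have "4 ^ card I * (r * r) \<le> (c * (?v * D ^ card I))\<^sup>2"
      using le real nn by (simp add: ennreal_power flip: ennreal_mult)
    also have "4 ^ card I * (r * r) = (2 ^ card I * r)\<^sup>2"
      by (simp add: power_mult_distrib power2_eq_square power_mult_distrib[symmetric])
    finally have "2 ^ card I * r \<le> c * (?v * D ^ card I)"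
      using nn by (rule power2_le_imp_le)
    then have "r \<le> c * (?v * (D / 2) ^ card I)"
      by (simp add: power_divide field_simps)
    then show ?thesis using real by (simp add: ennreal_leI)
  next
    case top
    then show ?thesis using le by (simp add: ennreal_mult_eq_top_iff top_unique power_eq_top_ennreal)
  qed
qed

section \<open>Integration along lines of a given direction\<close>

text \<open>Up to a null set, an open set is a countable disjoint union of balls, and an orthogonal
  map keeps the volume of a ball because it keeps the radius. Only one inequality results, since
  nothing is known yet about the preimage of the null set.\<close>

lemma emeasure_lborel_open_le_orthogonal_vimage:
  fixes Q :: "'a::euclidean_space \<Rightarrow> 'a"
  assumes Q: "orthogonal_transformation Q" and S: "open S"
  shows "emeasure lborel S \<le> emeasure lborel (Q -` S)"
proof -
  have bij: "bij Q" by (rule orthogonal_transformation_bij[OF Q])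
  have P: "orthogonal_transformation (inv Q)" by (rule orthogonal_transformation_inv[OF Q])
  have vim: "Q -` T = inv Q ` T" for T by (rule bij_vimage_eq_inv_image[OF bij])
  have cont: "continuous_on UNIV Q"
    using Q by (simp add: linear_continuous_on linear_linear orthogonal_transformation_linear)
  define K where "K = {p :: 'a \<times> real. 0 < snd p \<and> cball (fst p) (snd p) \<subseteq> S}"
  obtain C where C: "countable C" "C \<subseteq> K"
    and pw: "pairwise (\<lambda>i j. disjnt (cball (fst i) (snd i)) (cball (fst j) (snd j))) C"
    and neg: "negligible (S - (\<Union>i\<in>C. cball (fst i) (snd i)))"
  proof (rule Vitali_covering_theorem_cballs)
    show "0 < snd i" if "i \<in> K" for i using that by (simp add: K_def)
    fix x and d :: real assume x: "x \<in> S" "0 < d"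
    obtain e where e: "0 < e" "cball x e \<subseteq> S" using S x(1) by (auto simp: open_contains_cball)
    define r where "r = min (d / 2) e"
    have "cball x r \<subseteq> cball x e" by (auto simp: r_def)
    then have "(x, r) \<in> K" using e x by (auto simp: K_def r_def)
    then show "\<exists>i. i \<in> K \<and> x \<in> cball (fst i) (snd i) \<and> snd i < d"
      using x e by (intro exI[of _ "(x, r)"]) (auto simp: r_def)
  qed
  let ?B = "\<lambda>i::'a \<times> real. cball (fst i) (snd i)"
  let ?U = "\<Union>i\<in>C. ?B i"
  have mQ: "Q \<in> borel_measurable borel"
    using cont by (rule borel_measurable_continuous_onI)
  have disj: "disjoint_family_on ?B C"
    using pw unfolding disjoint_family_on_def pairwise_def disjnt_def by blast
  then have disjQ: "disjoint_family_on (\<lambda>i. Q -` ?B i) C"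
    unfolding disjoint_family_on_def by blast
  have US: "?U \<subseteq> S" using C(2) by (auto simp: K_def)
  have mS [measurable]: "S \<in> sets borel" using S by simp
  have mU [measurable]: "?U \<in> sets borel" using C(1) by (intro sets.countable_UN') auto
  have "emeasure lborel S = emeasure lborel (?U \<union> (S - ?U))"
    using US by (simp add: Un_absorb1)
  also have "\<dots> \<le> emeasure lborel ?U + emeasure lborel (S - ?U)"
    by (rule emeasure_subadditive) auto
  also have "emeasure lborel (S - ?U) = 0"
    using neg by (simp add: negligible_iff_null_sets null_sets_completion_iff null_setsD1)
  also have "emeasure lborel ?U = (\<integral>\<^sup>+i. emeasure lborel (?B i) \<partial>count_space C)"
    using C(1) disj by (intro emeasure_UN_countable) auto
  also have "\<dots> = (\<integral>\<^sup>+i. emeasure lborel (Q -` ?B i) \<partial>count_space C)"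
    using C(2)
    by (intro nn_integral_cong)
      (auto simp: vim image_orthogonal_transformation_cball[OF P] emeasure_cball K_def)
  also have "\<dots> = emeasure lborel (\<Union>i\<in>C. Q -` ?B i)"
    using C(1) disjQ measurable_sets[OF mQ] by (intro emeasure_UN_countable[symmetric]) auto
  also have "\<dots> \<le> emeasure lborel (Q -` S)"
    using US S by (intro emeasure_mono) (auto intro!: borel_open open_vimage cont)
  finally show ?thesis by simp
qed

lemma nn_integral_lborel_orthogonal:
  fixes Q :: "'a::euclidean_space \<Rightarrow> 'a"
  assumes Q: "orthogonal_transformation Q" and f: "f \<in> borel_measurable borel"
  shows "(\<integral>\<^sup>+x. f (Q x) \<partial>lborel) = (\<integral>\<^sup>+x. f x \<partial>lborel)"
proof -
  have P: "orthogonal_transformation (inv Q)" by (rule orthogonal_transformation_inv[OF Q])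
  have cont: "continuous_on UNIV Q"
    using Q by (simp add: linear_continuous_on linear_linear orthogonal_transformation_linear)
  then have mQ: "Q \<in> borel_measurable borel" by (rule borel_measurable_continuous_onI)
  have eq: "emeasure lborel (Q -` S) = emeasure lborel S" if S: "open S" for S
  proof (rule antisym)
    have "open (Q -` S)" using S cont by (intro open_vimage) auto
    \<comment> \<open>The reverse inequality is the same lemma for the inverse map and the open
      preimage of \<open>S\<close>.\<close>
    from emeasure_lborel_open_le_orthogonal_vimage[OF P this]
    show "emeasure lborel (Q -` S) \<le> emeasure lborel S"
      using orthogonal_transformation_surj[OF Q]
      by (simp add: vimage_comp[symmetric] vimage_def surj_f_inv_f)
  qed (rule emeasure_lborel_open_le_orthogonal_vimage[OF Q S])
  have "lborel = distr lborel borel Q"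
  proof (rule lborel_eqI)
    fix l u :: 'a assume "\<And>b. b \<in> Basis \<Longrightarrow> l \<bullet> b \<le> u \<bullet> b"
    then show "emeasure (distr lborel borel Q) (box l u) = (\<Prod>b\<in>Basis. (u - l) \<bullet> b)"
      using mQ by (simp add: emeasure_distr eq open_box emeasure_lborel_box)
  qed simp
  then have "(\<integral>\<^sup>+x. f x \<partial>lborel) = (\<integral>\<^sup>+x. f x \<partial>distr lborel borel Q)" by simp
  also have "\<dots> = (\<integral>\<^sup>+x. f (Q x) \<partial>lborel)"
    using mQ f by (intro nn_integral_distr) auto
  finally show ?thesis ..
qed

lemma nn_integral_lborel_split_Basis:
  fixes g :: "'a::euclidean_space \<Rightarrow> ennreal"
  assumes b: "b \<in> Basis" and [measurable]: "g \<in> borel_measurable borel"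
  shows "(\<integral>\<^sup>+x. g x \<partial>lborel) = (\<integral>\<^sup>+y. \<integral>\<^sup>+t. g ((\<Sum>i\<in>Basis - {b}. y i *\<^sub>R i) + t *\<^sub>R b) \<partial>lborel
      \<partial>PiM (Basis - {b}) (\<lambda>_. lborel))"
proof -
  interpret product_sigma_finite "\<lambda>_::'a. lborel :: real measure" by standard
  have ins: "Basis = insert b (Basis - {b})" using b by auto
  have "(\<integral>\<^sup>+x. g x \<partial>lborel) = (\<integral>\<^sup>+y. g (\<Sum>i\<in>Basis. y i *\<^sub>R i) \<partial>PiM Basis (\<lambda>_. lborel))"
    by (subst lborel_eq) (rule nn_integral_distr; measurable)
  also have "\<dots> = (\<integral>\<^sup>+y. g (\<Sum>i\<in>Basis. y i *\<^sub>R i) \<partial>PiM (insert b (Basis - {b})) (\<lambda>_. lborel))"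
    using ins by simp
  also have "\<dots> = (\<integral>\<^sup>+y. \<integral>\<^sup>+t. g (\<Sum>i\<in>Basis. (y(b := t)) i *\<^sub>R i) \<partial>lborel
      \<partial>PiM (Basis - {b}) (\<lambda>_. lborel))"
    using ins by (intro product_nn_integral_insert) auto
  also have "(\<lambda>y t. \<Sum>i\<in>Basis. (y(b := t)) i *\<^sub>R i) = (\<lambda>y t. (\<Sum>i\<in>Basis - {b}. y i *\<^sub>R i) + t *\<^sub>R b)"
    using b by (intro ext) (simp add: sum.remove[OF finite_Basis b] add.commute)
  finally show ?thesis by simp
qed

lemma norm_sum_Basis_diff:
  fixes b :: "'a::euclidean_space"
  shows "norm ((\<Sum>i\<in>Basis - {b}. x i *\<^sub>R i) - (\<Sum>i\<in>Basis - {b}. y i *\<^sub>R i))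
    = sqrt (\<Sum>i\<in>Basis - {b}. (x i - y i)\<^sup>2)"
proof -
  have 1: "(\<Sum>i\<in>Basis - {b}. x i *\<^sub>R i) - (\<Sum>i\<in>Basis - {b}. y i *\<^sub>R i)
      = (\<Sum>i\<in>Basis - {b}. (x i - y i) *\<^sub>R i)"
    by (simp add: sum_subtractf scaleR_diff_left)
  have "(norm (\<Sum>i\<in>Basis - {b}. (x i - y i) *\<^sub>R i))\<^sup>2 = (\<Sum>i\<in>Basis - {b}. (norm ((x i - y i) *\<^sub>R i))\<^sup>2)"
    by (rule norm_sum_Pythagorean) (auto simp: pairwise_def orthogonal_def inner_Basis)
  also have "\<dots> = (\<Sum>i\<in>Basis - {b}. (x i - y i)\<^sup>2)"
    by (rule sum.cong) simp_all
  finally show ?thesis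
    unfolding 1 by (intro real_sqrt_unique[symmetric] norm_ge_zero)
qed

lemma inner_sum_Basis_diff:
  fixes b :: "'a::euclidean_space"
  assumes "b \<in> Basis"
  shows "(\<Sum>i\<in>Basis - {b}. x i *\<^sub>R i) \<bullet> b = 0"
  using assms by (auto simp: inner_sum_left inner_Basis intro!: sum.neutral)

text \<open>
  Fubini in the direction \<open>\<nu>\<close>: the fibre integral is supported on the projection of the support
  of \<open>g\<close>, to which the isodiametric inequality in dimension \<open>n - 1\<close> applies.
\<close>

lemma nn_integral_le_fibres:
  fixes g :: "real^'n \<Rightarrow> ennreal" and \<nu> :: "real^'n"
  assumes \<nu>: "norm \<nu> = 1" and g: "g \<in> borel_measurable borel"
    and D: "0 < D" "\<And>u v. g u \<noteq> 0 \<Longrightarrow> g v \<noteq> 0 \<Longrightarrow> dist u v \<le> D"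
    and c: "0 \<le> c" "\<And>x. (\<integral>\<^sup>+t. g (x + t *\<^sub>R \<nu>) \<partial>lborel) \<le> ennreal c"
  shows "(\<integral>\<^sup>+x. g x \<partial>lborel)
    \<le> ennreal (c * (unit_ball_vol (real (CARD('n) - 1)) * (D / 2) ^ (CARD('n) - 1)))"
proof -
  obtain b :: "real^'n" where b: "b \<in> Basis" using nonempty_Basis by blast
  \<comment> \<open>\<open>Q\<close> turns the basis vector \<open>b\<close> into
    \<open>\<nu>\<close>, so lines in direction \<open>\<nu>\<close> become coordinate lines and
    Fubini applies.\<close>
  obtain Q where Q: "orthogonal_transformation Q" "Q b = \<nu>"
    using orthogonal_transformation_exists[of b \<nu>] \<nu> b by (auto simp: norm_Basis)
  interpret Q: linear Q by (rule orthogonal_transformation_linear[OF Q(1)])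
  let ?I = "Basis - {b}" and ?Y = "\<lambda>y. \<Sum>i\<in>Basis - {b}. y i *\<^sub>R i"
  have cont: "continuous_on UNIV Q"
    using Q by (simp add: linear_continuous_on linear_linear orthogonal_transformation_linear)
  have [measurable]: "Q \<in> borel_measurable borel"
    using cont by (rule borel_measurable_continuous_onI)
  note [measurable] = g
  have card: "card ?I = CARD('n) - 1" using b by simp
  define F where "F y = (\<integral>\<^sup>+t. g (Q (?Y y + t *\<^sub>R b)) \<partial>lborel)" for y
  have Feq: "F y = (\<integral>\<^sup>+t. g (Q (?Y y) + t *\<^sub>R \<nu>) \<partial>lborel)" for y
    unfolding F_def by (simp add: Q.add Q.scale Q(2))
  have "(\<integral>\<^sup>+x. g x \<partial>lborel) = (\<integral>\<^sup>+x. g (Q x) \<partial>lborel)"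
    by (rule nn_integral_lborel_orthogonal[symmetric, OF Q(1) g])
  also have "\<dots> = (\<integral>\<^sup>+y. F y \<partial>PiM ?I (\<lambda>_. lborel))"
    unfolding F_def by (rule nn_integral_lborel_split_Basis[OF b]) measurable
  also have "\<dots> \<le> ennreal (c * (unit_ball_vol (real (card ?I)) * (D / 2) ^ card ?I))"
  proof (rule isodiametric_PiM)
    show "F \<in> borel_measurable (PiM ?I (\<lambda>_. lborel))"
      unfolding F_def by measurable
    show "F y \<le> ennreal c" for y unfolding Feq by (rule c(2))
    fix x y :: "real^'n \<Rightarrow> real" assume nz: "F x \<noteq> 0" "F y \<noteq> 0"
    have "\<exists>t. g (Q (?Y z + t *\<^sub>R b)) \<noteq> 0" if "F z \<noteq> 0" for z
      using that unfolding F_def by (rule contrapos_np) simp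
    then obtain s t where st: "g (Q (?Y x + s *\<^sub>R b)) \<noteq> 0" "g (Q (?Y y + t *\<^sub>R b)) \<noteq> 0"
      using nz by meson
    have "norm (Q (?Y x + s *\<^sub>R b) - Q (?Y y + t *\<^sub>R b)) \<le> D"
      using D(2)[OF st] by (simp add: dist_norm)
    then have "norm (?Y x - ?Y y + (s - t) *\<^sub>R b) \<le> D"
      by (simp add: Q.diff[symmetric] orthogonal_transformation_norm[OF Q(1)] algebra_simps)
    \<comment> \<open>By Pythagoras, dropping the component along \<open>b\<close> does not increase
      the distance, so the diameter bound passes to the projections.\<close>
    moreover have "(norm (?Y x - ?Y y + (s - t) *\<^sub>R b))\<^sup>2 = (norm (?Y x - ?Y y))\<^sup>2 + (norm ((s - t) *\<^sub>R b))\<^sup>2"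
      using inner_sum_Basis_diff[OF b]
      by (intro norm_add_Pythagorean) (simp add: orthogonal_def inner_diff_left)
    then have "(norm (?Y x - ?Y y))\<^sup>2 \<le> (norm (?Y x - ?Y y + (s - t) *\<^sub>R b))\<^sup>2"
      by simp
    then have "norm (?Y x - ?Y y) \<le> norm (?Y x - ?Y y + (s - t) *\<^sub>R b)"
      by (rule power2_le_imp_le) simp
    ultimately show "sqrt (\<Sum>i\<in>?I. (x i - y i)\<^sup>2) \<le> D"
      unfolding norm_sum_Basis_diff by linarith
  qed (use c D in auto)
  finally show ?thesis unfolding card .
qed

text \<open>The lower counterpart: the fibres over a ball of the hyperplane are kept, and the exact
  volume of that ball takes the place of the isodiametric inequality. The ball is centred at the
  origin; \<open>layer_integral_ge\<close> translates the function instead.\<close>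

lemma nn_integral_ge_fibres:
  fixes g :: "real^'n \<Rightarrow> ennreal" and \<nu> :: "real^'n"
  assumes \<nu>: "norm \<nu> = 1" and g: "g \<in> borel_measurable borel"
    and \<rho>: "0 < \<rho>"
    and c: "0 \<le> c" "\<And>x. x \<bullet> \<nu> = 0 \<Longrightarrow> norm x \<le> \<rho> \<Longrightarrow> ennreal c \<le> (\<integral>\<^sup>+t. g (x + t *\<^sub>R \<nu>) \<partial>lborel)"
  shows "ennreal (c * (unit_ball_vol (real (CARD('n) - 1)) * \<rho> ^ (CARD('n) - 1)))
    \<le> (\<integral>\<^sup>+x. g x \<partial>lborel)"
proof -
  obtain b :: "real^'n" where b: "b \<in> Basis" using nonempty_Basis by blast
  obtain Q where Q: "orthogonal_transformation Q" "Q b = \<nu>"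
    using orthogonal_transformation_exists[of b \<nu>] \<nu> b by (auto simp: norm_Basis)
  interpret Q: linear Q by (rule orthogonal_transformation_linear[OF Q(1)])
  let ?I = "Basis - {b}" and ?Y = "\<lambda>y. \<Sum>i\<in>Basis - {b}. y i *\<^sub>R i"
  let ?P = "PiM ?I (\<lambda>_. lborel :: real measure)"
  let ?B = "{f. sqrt (\<Sum>i\<in>?I. (f i)\<^sup>2) \<le> \<rho>} \<inter> space ?P"
  have cont: "continuous_on UNIV Q"
    using Q by (simp add: linear_continuous_on linear_linear orthogonal_transformation_linear)
  have [measurable]: "Q \<in> borel_measurable borel"
    using cont by (rule borel_measurable_continuous_onI)
  note [measurable] = g
  have card: "card ?I = CARD('n) - 1" using b by simp
  have "?B = {f\<in>space ?P. sqrt (\<Sum>i\<in>?I. (f i)\<^sup>2) \<le> \<rho>}" by auto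
  also have "\<dots> \<in> sets ?P" by measurable
  finally have mB [measurable]: "?B \<in> sets ?P" .
  have "ennreal (c * (unit_ball_vol (real (card ?I)) * \<rho> ^ card ?I)) = ennreal c * emeasure ?P ?B"
    using emeasure_cball_aux[of ?I \<rho>] \<rho> c by (simp add: ennreal_mult)
  also have "\<dots> = (\<integral>\<^sup>+y. ennreal c * indicator ?B y \<partial>?P)"
    by (rule nn_integral_cmult_indicator[symmetric]) measurable
  also have "\<dots> \<le> (\<integral>\<^sup>+y. \<integral>\<^sup>+t. g (Q (?Y y + t *\<^sub>R b)) \<partial>lborel \<partial>?P)"
  proof (intro nn_integral_mono)
    fix y
    show "ennreal c * indicator ?B y \<le> (\<integral>\<^sup>+t. g (Q (?Y y + t *\<^sub>R b)) \<partial>lborel)"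
    proof (cases "y \<in> ?B")
      case True
      have "Q (?Y y) \<bullet> \<nu> = 0"
        using Q inner_sum_Basis_diff[OF b, of y]
        unfolding Q(2)[symmetric] by (simp add: orthogonal_transformation_def)
      moreover have "norm (Q (?Y y)) \<le> \<rho>"
        using True norm_sum_Basis_diff[of y b "\<lambda>_. 0"]
        by (simp add: orthogonal_transformation_norm[OF Q(1)])
      ultimately show ?thesis using c(2)[of "Q (?Y y)"] True by (simp add: Q.add Q.scale Q(2))
    qed simp
  qed
  also have "\<dots> = (\<integral>\<^sup>+x. g (Q x) \<partial>lborel)"
    by (rule nn_integral_lborel_split_Basis[OF b, symmetric]) measurable
  also have "\<dots> = (\<integral>\<^sup>+x. g x \<partial>lborel)"
    by (rule nn_integral_lborel_orthogonal[OF Q(1) g])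
  finally show ?thesis unfolding card .
qed

section \<open>Thin layers around a level set\<close>

text \<open>The mean value theorem on a segment. The direction \<open>w\<close> is left free because
  two kinds are used: \<open>\<nu>\<close>, along which \<open>f\<close> grows at rate about
  \<open>norm v\<close>, and displacements orthogonal to \<open>v\<close>, along which
  \<open>f\<close> hardly changes.\<close>

lemma growth_along_direction:
  fixes f :: "'a::euclidean_space \<Rightarrow> real" and G :: "'a \<Rightarrow> 'a"
  assumes der: "\<And>x. x \<in> U \<Longrightarrow> (f has_derivative (\<lambda>h. G x \<bullet> h)) (at x)"
    and U: "convex U" and G: "\<And>x. x \<in> U \<Longrightarrow> norm (G x - v) \<le> \<epsilon> * norm v"
    and w: "x + s *\<^sub>R w \<in> U" "x + t *\<^sub>R w \<in> U" "s \<le> t"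
  shows "(v \<bullet> w - \<epsilon> * norm v * norm w) * (t - s) \<le> f (x + t *\<^sub>R w) - f (x + s *\<^sub>R w)"
    and "f (x + t *\<^sub>R w) - f (x + s *\<^sub>R w) \<le> (v \<bullet> w + \<epsilon> * norm v * norm w) * (t - s)"
proof -
  have inU: "x + r *\<^sub>R w \<in> U" if "s \<le> r" "r \<le> t" for r
  proof (cases "s = t")
    case False
    define q where "q = (r - s) / (t - s)"
    have q: "0 \<le> q" "q \<le> 1" using that False by (auto simp: q_def field_simps)
    have "q * (t - s) = r - s" using False by (simp add: q_def)
    then have r_eq: "(1 - q) * s + q * t = r" by (simp add: algebra_simps)
    have "(1 - q) *\<^sub>R (x + s *\<^sub>R w) + q *\<^sub>R (x + t *\<^sub>R w) = x + ((1 - q) * s + q * t) *\<^sub>R w"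
      by (simp add: algebra_simps)
    then have "x + r *\<^sub>R w = (1 - q) *\<^sub>R (x + s *\<^sub>R w) + q *\<^sub>R (x + t *\<^sub>R w)"
      unfolding r_eq by simp
    then show ?thesis using convexD_alt[OF U w(1,2) q] by simp
  qed (use that w in auto)
  have slope: "\<bar>G y \<bullet> w - v \<bullet> w\<bar> \<le> \<epsilon> * norm v * norm w" if "y \<in> U" for y
  proof -
    have "\<bar>G y \<bullet> w - v \<bullet> w\<bar> = \<bar>(G y - v) \<bullet> w\<bar>" by (simp add: inner_diff_left)
    also have "\<dots> \<le> norm (G y - v) * norm w" by (rule Cauchy_Schwarz_ineq2)
    also have "\<dots> \<le> \<epsilon> * norm v * norm w" by (intro mult_right_mono G that) simp
    finally show ?thesis .
  qed
  have "(v \<bullet> w - \<epsilon> * norm v * norm w) * (t - s) \<le> f (x + t *\<^sub>R w) - f (x + s *\<^sub>R w) \<and>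
     f (x + t *\<^sub>R w) - f (x + s *\<^sub>R w) \<le> (v \<bullet> w + \<epsilon> * norm v * norm w) * (t - s)"
  proof (cases "s = t")
    case False
    then have "s < t" using w by simp
    moreover have "((\<lambda>r. f (x + r *\<^sub>R w)) has_real_derivative G (x + r *\<^sub>R w) \<bullet> w) (at r)"
      if "s \<le> r" "r \<le> t" for r
    proof -
      have "((\<lambda>r. x + r *\<^sub>R w) has_derivative (\<lambda>h. h *\<^sub>R w)) (at r)"
        by (auto intro!: derivative_eq_intros)
      moreover have "(f has_derivative (\<lambda>h. G (x + r *\<^sub>R w) \<bullet> h)) (at (x + r *\<^sub>R w))"
        by (rule der[OF inU[OF that]])
      ultimately have "((\<lambda>r. f (x + r *\<^sub>R w)) has_derivative (\<lambda>h. G (x + r *\<^sub>R w) \<bullet> (h *\<^sub>R w))) (at r)"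
        by (rule has_derivative_compose)
      then show ?thesis
        by (rule has_derivative_imp_has_field_derivative) simp
    qed
    ultimately obtain r where r: "s < r" "r < t"
      "f (x + t *\<^sub>R w) - f (x + s *\<^sub>R w) = (t - s) * (G (x + r *\<^sub>R w) \<bullet> w)"
      using MVT2[of s t "\<lambda>r. f (x + r *\<^sub>R w)" "\<lambda>r. G (x + r *\<^sub>R w) \<bullet> w"] by auto
    have "\<bar>G (x + r *\<^sub>R w) \<bullet> w - v \<bullet> w\<bar> \<le> \<epsilon> * norm v * norm w"
      using r inU by (intro slope) auto
    then have "v \<bullet> w - \<epsilon> * norm v * norm w \<le> G (x + r *\<^sub>R w) \<bullet> w"
      "G (x + r *\<^sub>R w) \<bullet> w \<le> v \<bullet> w + \<epsilon> * norm v * norm w"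
      by linarith+
    then show ?thesis
      using \<open>s < t\<close> unfolding r(3) mult.commute[of "t - s"]
      by (intro conjI mult_right_mono) simp_all
  qed auto
  then show "(v \<bullet> w - \<epsilon> * norm v * norm w) * (t - s) \<le> f (x + t *\<^sub>R w) - f (x + s *\<^sub>R w)"
    and "f (x + t *\<^sub>R w) - f (x + s *\<^sub>R w) \<le> (v \<bullet> w + \<epsilon> * norm v * norm w) * (t - s)"
    by auto
qed

text \<open>On a fibre \<open>f\<close> climbs at rate at least
  \<open>(1 - \<epsilon>) * norm v\<close>, while the weight is at most
  \<open>(1 + \<epsilon>) * norm v\<close>. The factor \<open>norm v\<close> cancels, which leaves a
  bound in terms of \<open>\<epsilon>\<close>, \<open>s\<close> and \<open>D\<close>.\<close>

lemma layer_integral_le: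
  fixes f :: "real^'n \<Rightarrow> real" and G :: "real^'n \<Rightarrow> real^'n"
  assumes der: "\<And>x. x \<in> U \<Longrightarrow> (f has_derivative (\<lambda>h. G x \<bullet> h)) (at x)"
    and U: "convex U" and G: "\<And>x. x \<in> U \<Longrightarrow> norm (G x - v) \<le> \<epsilon> * norm v"
    and v: "v \<noteq> 0" and \<epsilon>: "0 \<le> \<epsilon>" "\<epsilon> < 1"
    and [measurable]: "f \<in> borel_measurable borel" "G \<in> borel_measurable borel" "N \<in> sets borel"
    and N: "N \<subseteq> U" and D: "0 < D" "\<And>x y. x \<in> N \<Longrightarrow> y \<in> N \<Longrightarrow> dist x y \<le> D" and s: "0 < s"
  shows "(\<integral>\<^sup>+x. ennreal (norm (G x)) * indicator (N \<inter> {x. 0 < \<bar>f x\<bar> \<and> \<bar>f x\<bar> \<le> s}) x \<partial>lborel)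
    \<le> ennreal ((1 + \<epsilon>) / (1 - \<epsilon>) * (2 * s) * (unit_ball_vol (real (CARD('n) - 1)) * (D / 2) ^ (CARD('n) - 1)))"
proof (rule nn_integral_le_fibres)
  let ?\<nu> = "v /\<^sub>R norm v"
  let ?g = "\<lambda>x. ennreal (norm (G x)) * indicator (N \<inter> {x. 0 < \<bar>f x\<bar> \<and> \<bar>f x\<bar> \<le> s}) x"
  show \<nu>: "norm ?\<nu> = 1" using v by simp
  have v\<nu>: "v \<bullet> ?\<nu> = norm v" using v by (simp add: power2_norm_eq_inner[symmetric] power2_eq_square)
  have "{x\<in>space borel. 0 < \<bar>f x\<bar> \<and> \<bar>f x\<bar> \<le> s} \<in> sets borel" by measurable
  then have S: "{x. 0 < \<bar>f x\<bar> \<and> \<bar>f x\<bar> \<le> s} \<in> sets borel" by simp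
  show "?g \<in> borel_measurable borel"
    using S by (intro borel_measurable_times_ennreal borel_measurable_indicator sets.Int) auto
  show "0 < D" by fact
  show "dist x y \<le> D" if "?g x \<noteq> 0" "?g y \<noteq> 0" for x y
    using that D(2) by (auto simp: indicator_def split: if_splits)
  show "0 \<le> (1 + \<epsilon>) / (1 - \<epsilon>) * (2 * s)" using \<epsilon> s by simp
  fix x
  define T where "T = {t. x + t *\<^sub>R ?\<nu> \<in> N \<and> \<bar>f (x + t *\<^sub>R ?\<nu>)\<bar> \<le> s}"
  define l where "l = 2 * s / ((1 - \<epsilon>) * norm v)"
  have l: "0 \<le> l" using s \<epsilon> by (simp add: l_def)
  have len: "t' - t \<le> l" if "t \<in> T" "t' \<in> T" for t t'
  proof (cases "t \<le> t'")
    case True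
    have "(norm v - \<epsilon> * norm v) * (t' - t) \<le> f (x + t' *\<^sub>R ?\<nu>) - f (x + t *\<^sub>R ?\<nu>)"
      using growth_along_direction(1)[OF der U G, of x t ?\<nu> t'] that N True
      unfolding v\<nu> \<nu> by (auto simp: T_def)
    also have "\<dots> \<le> 2 * s" using that by (auto simp: T_def)
    finally have "(1 - \<epsilon>) * norm v * (t' - t) \<le> 2 * s" by (simp add: algebra_simps)
    then show ?thesis using v \<epsilon> by (simp add: l_def field_simps)
  qed (use l in auto)
  \<comment> \<open>\<open>N\<close> is arbitrary, so \<open>T\<close> need not be an interval; the
    bound on its pairwise distances still places it in one of length \<open>l\<close>.\<close>
  obtain a where a: "T \<subseteq> {a .. a + l}"
  proof (cases "T = {}")
    case False
    then obtain t0 where t0: "t0 \<in> T" by auto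
    have bdd: "bdd_below T"
      using len[OF _ t0] by (intro bdd_belowI[of _ "t0 - l"]) (auto simp: algebra_simps)
    have "T \<subseteq> {Inf T .. Inf T + l}"
    proof
      fix t assume t: "t \<in> T"
      have "t - l \<le> Inf T"
        by (rule cInf_greatest) (use False len[OF _ t] in \<open>auto simp: algebra_simps\<close>)
      then show "t \<in> {Inf T .. Inf T + l}" using cInf_lower[OF t bdd] by auto
    qed
    then show thesis by (rule that)
  qed (auto intro: that)
  have "(\<integral>\<^sup>+t. ?g (x + t *\<^sub>R ?\<nu>) \<partial>lborel) \<le> (\<integral>\<^sup>+t. ennreal ((1 + \<epsilon>) * norm v) * indicator {a .. a + l} t \<partial>lborel)"
  proof (rule nn_integral_mono)
    fix t
    show "?g (x + t *\<^sub>R ?\<nu>) \<le> ennreal ((1 + \<epsilon>) * norm v) * indicator {a .. a + l} t"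
    proof (cases "t \<in> T")
      case True
      then have "x + t *\<^sub>R ?\<nu> \<in> U" using N by (auto simp: T_def)
      then have "norm (G (x + t *\<^sub>R ?\<nu>)) \<le> (1 + \<epsilon>) * norm v"
        using G norm_triangle_sub[of "G (x + t *\<^sub>R ?\<nu>)" v] by (fastforce simp: algebra_simps)
      then have "ennreal (norm (G (x + t *\<^sub>R ?\<nu>))) * indicator (N \<inter> {x. 0 < \<bar>f x\<bar> \<and> \<bar>f x\<bar> \<le> s}) (x + t *\<^sub>R ?\<nu>)
         \<le> ennreal ((1 + \<epsilon>) * norm v) * 1"
        by (intro mult_mono ennreal_leI) (auto simp: indicator_def)
      moreover have "t \<in> {a .. a + l}" using True a by auto
      ultimately show ?thesis by simp
    qed (auto simp: T_def indicator_def)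
  qed
  also have "\<dots> = ennreal ((1 + \<epsilon>) * norm v) * ennreal l"
    using l by (simp add: nn_integral_cmult_indicator)
  also have "\<dots> = ennreal ((1 + \<epsilon>) / (1 - \<epsilon>) * (2 * s))"
    using v \<epsilon> l by (simp add: ennreal_mult[symmetric] l_def)
  finally show "(\<integral>\<^sup>+t. ?g (x + t *\<^sub>R ?\<nu>) \<partial>lborel) \<le> ennreal ((1 + \<epsilon>) / (1 - \<epsilon>) * (2 * s))" .
qed

lemma layer_integral_ge:
  fixes f :: "real^'n \<Rightarrow> real" and G :: "real^'n \<Rightarrow> real^'n"
  assumes der: "\<And>x. x \<in> cball z r \<Longrightarrow> (f has_derivative (\<lambda>h. G x \<bullet> h)) (at x)"
    and G: "\<And>x. x \<in> cball z r \<Longrightarrow> norm (G x - v) \<le> \<epsilon> * norm v"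
    and v: "v \<noteq> 0" and \<epsilon>: "0 < \<epsilon>" "\<epsilon> \<le> 1 / 2"
    and meas [measurable]: "f \<in> borel_measurable borel" "G \<in> borel_measurable borel"
    and z: "f z = 0" and r: "0 < r" and s: "0 < s" "s \<le> \<epsilon> * norm v * (r / (1 + 4 * \<epsilon>))"
  shows "ennreal ((1 - \<epsilon>) / (1 + \<epsilon>) * (2 * s) *
      (unit_ball_vol (real (CARD('n) - 1)) * (r / (1 + 4 * \<epsilon>)) ^ (CARD('n) - 1)))
    \<le> (\<integral>\<^sup>+x. ennreal (norm (G x)) * indicator (cball z r \<inter> {x. 0 < \<bar>f x\<bar> \<and> \<bar>f x\<bar> \<le> s}) x \<partial>lborel)"
proof -
  let ?\<nu> = "v /\<^sub>R norm v"
  let ?g = "\<lambda>x. ennreal (norm (G x)) * indicator (cball z r \<inter> {x. 0 < \<bar>f x\<bar> \<and> \<bar>f x\<bar> \<le> s}) x"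
  \<comment> \<open>A cylinder with base radius \<open>\<rho>\<close> and half-height
    \<open>\<tau>\<close> fits into the ball because \<open>\<rho> + \<tau> = r\<close>. On the base
    \<open>\<bar>f\<bar>\<close> is at most \<open>\<epsilon> * norm v * \<rho>\<close>, as
    displacements there are orthogonal to \<open>v\<close>. Since
    \<open>\<epsilon> \<le> 1 / 2\<close>, the factor 4 makes the climb over the height
    \<open>\<tau>\<close> at least twice that, so \<open>f\<close> passes through both
    \<open>- s\<close> and \<open>s\<close> on every fibre.\<close>
  define \<rho> where "\<rho> = r / (1 + 4 * \<epsilon>)"
  define \<tau> where "\<tau> = 4 * \<epsilon> * \<rho>"
  have "\<rho> * (1 + 4 * \<epsilon>) = r" using \<epsilon> by (simp add: \<rho>_def)
  moreover have "0 < \<rho>" using r \<epsilon> by (simp add: \<rho>_def)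
  ultimately have \<rho>: "0 < \<rho>" "0 < \<tau>" "\<rho> + \<tau> = r"
    using \<epsilon> by (simp_all add: \<tau>_def algebra_simps)
  have \<nu>: "norm ?\<nu> = 1" using v by simp
  have v\<nu>: "v \<bullet> ?\<nu> = norm v" using v by (simp add: power2_norm_eq_inner[symmetric] power2_eq_square)
  have grow: "(v \<bullet> w - \<epsilon> * norm v * norm w) * (t' - t) \<le> f (x + t' *\<^sub>R w) - f (x + t *\<^sub>R w)"
    "f (x + t' *\<^sub>R w) - f (x + t *\<^sub>R w) \<le> (v \<bullet> w + \<epsilon> * norm v * norm w) * (t' - t)"
    if "x + t *\<^sub>R w \<in> cball z r" "x + t' *\<^sub>R w \<in> cball z r" "t \<le> t'" for x w t t'
    by (rule growth_along_direction[where U = "cball z r" and G = G]; (rule convex_cball | fact))+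
  have "{x\<in>space borel. 0 < \<bar>f x\<bar> \<and> \<bar>f x\<bar> \<le> s} \<in> sets borel" by measurable
  then have S: "{x. 0 < \<bar>f x\<bar> \<and> \<bar>f x\<bar> \<le> s} \<in> sets borel" by simp
  have mg: "?g \<in> borel_measurable borel"
    using S by (intro borel_measurable_times_ennreal borel_measurable_indicator sets.Int) auto
  have "ennreal ((1 - \<epsilon>) / (1 + \<epsilon>) * (2 * s) * (unit_ball_vol (real (CARD('n) - 1)) * \<rho> ^ (CARD('n) - 1)))
     \<le> (\<integral>\<^sup>+x. ?g (z + x) \<partial>lborel)"
  proof (rule nn_integral_ge_fibres)
    show "norm ?\<nu> = 1" "0 < \<rho>" by fact+
    show "(\<lambda>x. ?g (z + x)) \<in> borel_measurable borel"
      by (rule measurable_compose[OF _ mg]) simp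
    show "0 \<le> (1 - \<epsilon>) / (1 + \<epsilon>) * (2 * s)" using \<epsilon> s by simp
    fix y :: "real^'n" assume y: "y \<bullet> ?\<nu> = 0" "norm y \<le> \<rho>"
    have vy: "v \<bullet> y = 0" using y v by (simp add: inner_commute)
    define \<phi> where "\<phi> t = f ((z + y) + t *\<^sub>R ?\<nu>)" for t
    have inU: "(z + y) + t *\<^sub>R ?\<nu> \<in> cball z r" if "\<bar>t\<bar> \<le> \<tau>" for t
    proof -
      have "norm (y + t *\<^sub>R ?\<nu>) \<le> norm y + norm (t *\<^sub>R ?\<nu>)" by (rule norm_triangle_ineq)
      also have "norm (t *\<^sub>R ?\<nu>) = \<bar>t\<bar>" using v by (simp add: abs_mult)
      finally have "norm (y + t *\<^sub>R ?\<nu>) \<le> r" using that y \<rho> by linarith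
      moreover have "dist z (z + y + t *\<^sub>R ?\<nu>) = norm (y + t *\<^sub>R ?\<nu>)"
        by (metis add.assoc add_diff_cancel_left' dist_commute dist_norm)
      ultimately show ?thesis by simp
    qed
    have gr: "(1 - \<epsilon>) * norm v * (t' - t) \<le> \<phi> t' - \<phi> t" "\<phi> t' - \<phi> t \<le> (1 + \<epsilon>) * norm v * (t' - t)"
      if "\<bar>t\<bar> \<le> \<tau>" "\<bar>t'\<bar> \<le> \<tau>" "t \<le> t'" for t t'
    proof -
      have "(norm v - \<epsilon> * norm v * 1) * (t' - t) \<le> \<phi> t' - \<phi> t"
        "\<phi> t' - \<phi> t \<le> (norm v + \<epsilon> * norm v * 1) * (t' - t)"
        using grow[OF inU[OF that(1)] inU[OF that(2)] that(3)] unfolding v\<nu> \<nu> \<phi>_def .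
      then show "(1 - \<epsilon>) * norm v * (t' - t) \<le> \<phi> t' - \<phi> t" "\<phi> t' - \<phi> t \<le> (1 + \<epsilon>) * norm v * (t' - t)"
        by (simp_all add: algebra_simps)
    qed
    have "\<bar>f (z + y) - f z\<bar> \<le> \<epsilon> * norm v * norm y"
    proof -
      have "z + 0 *\<^sub>R y \<in> cball z r" "z + 1 *\<^sub>R y \<in> cball z r" using y \<rho> r by (auto simp: dist_norm)
      from grow[OF this] show ?thesis by (simp add: vy)
    qed
    also have "\<dots> \<le> \<epsilon> * norm v * \<rho>" using y \<epsilon> by (intro mult_left_mono) auto
    finally have \<phi>0: "\<bar>\<phi> 0\<bar> \<le> \<epsilon> * norm v * \<rho>" using z by (simp add: \<phi>_def)
    have "\<epsilon> * norm v * \<rho> * 2 \<le> \<epsilon> * norm v * \<rho> * (4 * (1 - \<epsilon>))"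
      using \<epsilon> \<rho> by (intro mult_left_mono) auto
    then have "2 * (\<epsilon> * norm v * \<rho>) \<le> (1 - \<epsilon>) * norm v * \<tau>"
      by (simp add: \<tau>_def mult_ac)
    then have ends: "s \<le> \<phi> \<tau>" "\<phi> (- \<tau>) \<le> - s"
      using gr(1)[of 0 \<tau>] gr(1)[of "-\<tau>" 0] \<phi>0 s(2) \<rho> unfolding \<rho>_def[symmetric] by auto
    have strict: "\<phi> t < \<phi> t'" if "\<bar>t\<bar> \<le> \<tau>" "\<bar>t'\<bar> \<le> \<tau>" "t < t'" for t t'
    proof -
      have "0 < (1 - \<epsilon>) * norm v * (t' - t)" using that v \<epsilon> by simp
      then show ?thesis using gr(1)[of t t'] that by auto
    qed
    have cont: "continuous_on {-\<tau>..\<tau>} \<phi>"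
    proof (rule continuous_at_imp_continuous_on, rule ballI)
      fix t assume "t \<in> {-\<tau>..\<tau>}"
      then have "(z + y) + t *\<^sub>R ?\<nu> \<in> cball z r" by (intro inU) auto
      then have "isCont f ((z + y) + t *\<^sub>R ?\<nu>)"
        by (rule has_derivative_continuous[OF der])
      moreover have "isCont (\<lambda>t. (z + y) + t *\<^sub>R ?\<nu>) t"
        by (intro continuous_intros)
      ultimately show "isCont \<phi> t"
        unfolding \<phi>_def by (rule isCont_o2[rotated])
    qed
    have ivt: "\<exists>t. \<bar>t\<bar> \<le> \<tau> \<and> \<phi> t = q" if "-s \<le> q" "q \<le> s" for q
    proof -
      have "\<exists>t\<ge>-\<tau>. t \<le> \<tau> \<and> \<phi> t = q"
        using ends that \<rho> cont by (intro IVT') auto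
      then show ?thesis by (auto simp: abs_le_iff minus_le_iff)
    qed
    obtain t1 where t1: "\<bar>t1\<bar> \<le> \<tau>" "\<phi> t1 = - s" using ivt[of "-s"] s(1) by auto
    obtain t2 where t2: "\<bar>t2\<bar> \<le> \<tau>" "\<phi> t2 = s" using ivt[of s] s(1) by auto
    \<comment> \<open>The layer omits the zeros of \<open>f\<close>. By strict monotonicity
      \<open>t0\<close> is the only one on this fibre, and a single point has no length.\<close>
    obtain t0 where t0: "\<bar>t0\<bar> \<le> \<tau>" "\<phi> t0 = 0" using ivt[of 0] s(1) by auto
    have t12: "t1 < t2"
      using strict[of t2 t1] t1 t2 s by (cases t1 t2 rule: linorder_cases) auto
    have "2 * s \<le> (1 + \<epsilon>) * norm v * (t2 - t1)"
      using gr(2)[of t1 t2] t1 t2 t12 by auto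
    then have "(1 - \<epsilon>) / (1 + \<epsilon>) * (2 * s) \<le> (1 - \<epsilon>) / (1 + \<epsilon>) * ((1 + \<epsilon>) * norm v * (t2 - t1))"
      using \<epsilon> by (intro mult_left_mono) auto
    also have "\<dots> = (1 - \<epsilon>) * norm v * (t2 - t1)"
      using \<epsilon> by simp
    finally have "ennreal ((1 - \<epsilon>) / (1 + \<epsilon>) * (2 * s)) \<le> ennreal ((1 - \<epsilon>) * norm v) * ennreal (t2 - t1)"
      using \<epsilon> t12 by (simp add: ennreal_mult[symmetric] ennreal_leI)
    also have "ennreal (t2 - t1) = emeasure lborel ({t1..t2} - {t0})"
    proof -
      have "emeasure lborel {t1..t2} = emeasure lborel ({t1..t2} - {t0})"
        by (rule emeasure_Diff_null_set[symmetric]) auto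
      then show ?thesis using t12 by simp
    qed
    also have "ennreal ((1 - \<epsilon>) * norm v) * \<dots> = (\<integral>\<^sup>+t. ennreal ((1 - \<epsilon>) * norm v) * indicator ({t1..t2} - {t0}) t \<partial>lborel)"
      by (rule nn_integral_cmult_indicator[symmetric]) simp
    also have "\<dots> \<le> (\<integral>\<^sup>+t. ?g (z + (y + t *\<^sub>R ?\<nu>)) \<partial>lborel)"
    proof (rule nn_integral_mono)
      fix t
      show "ennreal ((1 - \<epsilon>) * norm v) * indicator ({t1..t2} - {t0}) t \<le> ?g (z + (y + t *\<^sub>R ?\<nu>))"
      proof (cases "t \<in> {t1..t2} - {t0}")
        case True
        then have t: "t1 \<le> t" "t \<le> t2" "t \<noteq> t0" "\<bar>t\<bar> \<le> \<tau>" using t1 t2 by auto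
        have "- s \<le> \<phi> t" using strict[of t1 t] t t1 by (cases "t = t1") auto
        moreover have "\<phi> t \<le> s" using strict[of t t2] t t2 by (cases "t = t2") auto
        moreover have "\<phi> t \<noteq> 0"
          using strict[of t t0] strict[of t0 t] t t0 by (cases t t0 rule: linorder_cases) auto
        ultimately have "0 < \<bar>\<phi> t\<bar> \<and> \<bar>\<phi> t\<bar> \<le> s" by auto
        moreover have "norm v \<le> norm (G (z + y + t *\<^sub>R ?\<nu>)) + \<epsilon> * norm v"
          using G[OF inU[OF t(4)]] norm_triangle_sub[of v "G (z + y + t *\<^sub>R ?\<nu>)"]
          by (simp add: norm_minus_commute)
        ultimately have X: "0 < \<bar>f (z + (y + t *\<^sub>R ?\<nu>))\<bar>" "\<bar>f (z + (y + t *\<^sub>R ?\<nu>))\<bar> \<le> s"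
          "(1 - \<epsilon>) * norm v \<le> norm (G (z + (y + t *\<^sub>R ?\<nu>)))"
          unfolding \<phi>_def add.assoc left_diff_distrib by linarith+
        moreover have "z + (y + t *\<^sub>R ?\<nu>) \<in> cball z r"
          using inU[OF t(4)] unfolding add.assoc .
        ultimately have "z + (y + t *\<^sub>R ?\<nu>) \<in> cball z r \<inter> {x. 0 < \<bar>f x\<bar> \<and> \<bar>f x\<bar> \<le> s}"
          by blast
        then show ?thesis
          using True ennreal_leI[OF X(3)] by (simp only: indicator_simps mult_1_right)
      qed simp
    qed
    finally show "ennreal ((1 - \<epsilon>) / (1 + \<epsilon>) * (2 * s)) \<le> (\<integral>\<^sup>+t. ?g (z + (y + t *\<^sub>R ?\<nu>)) \<partial>lborel)" .
  qed
  also have "\<dots> = (\<integral>\<^sup>+x. ?g x \<partial>distr lborel borel ((+) z))"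
    using mg by (intro nn_integral_distr[symmetric]) (simp_all only: measurable_distr_eq1, simp)
  finally show ?thesis
    by (simp only: lborel_distr_plus \<rho>_def)
qed

section \<open>Layers and Hausdorff measure\<close>

lemma hausdorff_size_cball:
  fixes z :: "'a::euclidean_space"
  assumes "0 < r"
  shows "hausdorff_size m (cball z r) = ennreal (unit_ball_vol (real m) * r ^ m)"
  using assms by (simp add: hausdorff_size_def)

text \<open>
  The first \<open>N\<close> balls of the Vitali family and the fivefold enlargements of the remaining ones cover
  \<open>Z\<close>; the latter cost arbitrarily little because the sizes are summable.
\<close>

lemma hausdorff_content_le_disjoint_balls:
  fixes Z :: "'a::euclidean_space set"
  assumes \<rho>: "0 < \<rho>" "10 * \<rho> \<le> d"
    and bound: "\<And>F. finite F \<Longrightarrow> (\<And>z r. (z, r) \<in> F \<Longrightarrow> z \<in> Z \<and> 0 < r \<and> r \<le> \<rho>) \<Longrightarrow>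
      pairwise (\<lambda>i j. disjnt (cball (fst i) (snd i)) (cball (fst j) (snd j))) F \<Longrightarrow>
      (\<Sum>i\<in>F. unit_ball_vol (real m) * snd i ^ m) \<le> S"
  shows "hausdorff_content m d Z \<le> ennreal S"
proof -
  let ?v = "unit_ball_vol (real m)"
  define K where "K = Z \<times> {0<..\<rho>}"
  have Kr: "0 < snd i \<and> snd i \<le> \<rho>" if "i \<in> K" for i
    using that by (auto simp: K_def)
  obtain C where C: "countable C" "C \<subseteq> K"
    and disj: "pairwise (\<lambda>i j. disjnt (cball (fst i) (snd i)) (cball (fst j) (snd j))) C"
    and cov: "\<And>i. i \<in> K \<Longrightarrow> \<exists>j. j \<in> C \<and>
        \<not> disjnt (cball (fst i) (snd i)) (cball (fst j) (snd j)) \<and>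
        cball (fst i) (snd i) \<subseteq> ball (fst j) (5 * snd j)"
    by (rule Vitali_covering_lemma_cballs_balls[OF Kr, where a = fst]) (blast intro: that)+
  \<comment> \<open>\<open>C\<close> may be finite, so it is indexed by a set \<open>I\<close> of
    naturals. Indices outside \<open>I\<close> carry the empty set, which has size 0 even when
    \<open>m = 0\<close>.\<close>
  define I where "I = to_nat_on C ` C"
  define c where "c = from_nat_into C"
  have c_to_nat: "c (to_nat_on C j) = j" if "j \<in> C" for j
    unfolding c_def by (rule from_nat_into_to_nat_on[OF C(1) that])
  have cC: "c n \<in> C" if "n \<in> I" for n
    using that c_to_nat by (auto simp: I_def)
  have cK: "fst (c n) \<in> Z" "0 < snd (c n)" "snd (c n) \<le> \<rho>" if "n \<in> I" for n
  proof -
    have "c n \<in> K" by (rule subsetD[OF C(2) cC[OF that]])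
    then show "fst (c n) \<in> Z" "0 < snd (c n)" "snd (c n) \<le> \<rho>"
      by (simp_all add: K_def mem_Times_iff)
  qed
  have surj: "\<exists>n\<in>I. c n = j" if "j \<in> C" for j
    unfolding I_def using c_to_nat[OF that] that by (intro bexI[of _ "to_nat_on C j"]) simp_all
  have inj: "inj_on c I"
    using c_to_nat by (intro inj_onI) (auto simp: I_def)
  define w where "w n = (if n \<in> I then ?v * snd (c n) ^ m else 0)" for n
  have w0: "0 \<le> w n" for n
    using cK(2)[of n] by (auto simp: w_def less_imp_le)
  have wS: "sum w F \<le> S" if "finite F" for F
  proof -
    have "sum w F = sum w (F \<inter> I)"
      using that by (intro sum.mono_neutral_right) (auto simp: w_def)
    also have "\<dots> = (\<Sum>n\<in>F \<inter> I. ?v * snd (c n) ^ m)"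
      by (intro sum.cong) (auto simp: w_def)
    also have "\<dots> = (\<Sum>i\<in>c ` (F \<inter> I). ?v * snd i ^ m)"
      using inj by (subst sum.reindex) (auto intro: inj_on_subset)
    also have "\<dots> \<le> S"
    proof (rule bound)
      show "finite (c ` (F \<inter> I))" using that by simp
      have sub: "c ` (F \<inter> I) \<subseteq> C" using cC by auto
      then show "pairwise (\<lambda>i j. disjnt (cball (fst i) (snd i)) (cball (fst j) (snd j))) (c ` (F \<inter> I))"
        using disj pairwise_subset by blast
      show "z \<in> Z \<and> 0 < r \<and> r \<le> \<rho>" if "(z, r) \<in> c ` (F \<inter> I)" for z r
      proof -
        have "(z, r) \<in> K" using that sub C(2) by blast
        then show ?thesis by (simp add: K_def)
      qed
    qed
    finally show ?thesis .
  qed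
  have summ: "summable w"
    by (rule summableI_nonneg_bounded[OF w0 wS]) simp
  define T where "T = suminf w"
  have T: "w sums T" using summ by (simp add: T_def summable_sums)
  have TS: "T \<le> S"
    unfolding T_def by (rule suminf_le_const[OF summ wS]) simp
  have "0 \<le> S" using wS[of "{}"] by simp
  show ?thesis
  proof (rule ennreal_le_epsilon)
    fix e :: real assume e: "0 < e"
    obtain N where N: "\<bar>sum w {..<N} - T\<bar> < e / 5 ^ m"
    proof -
      have "(\<lambda>n. sum w {..<n}) \<longlonglongrightarrow> T" using T by (simp add: sums_def)
      from LIMSEQ_D[OF this, of "e / 5 ^ m"] show thesis using e that by auto
    qed
    define E where "E n = (if n \<in> I then cball (fst (c n)) (if n < N then snd (c n) else 5 * snd (c n)) else {})" for n
    have "Z \<subseteq> (\<Union>n. E n)"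
    proof
      fix z assume z: "z \<in> Z"
      let ?B = "\<Union>n\<in>{..<N} \<inter> I. cball (fst (c n)) (snd (c n))"
      show "z \<in> (\<Union>n. E n)"
      proof (cases "z \<in> ?B")
        case True
        then show ?thesis by (auto simp: E_def)
      next
        case False
        \<comment> \<open>A point outside the first \<open>N\<close> balls has a small ball that
          avoids them all. The Vitali ball that meets this small ball, and whose enlargement
          contains it, must therefore come later in the enumeration.\<close>
        have "closed ?B" by (intro closed_UN) auto
        then have "open (- ?B)" by (rule open_Compl)
        then obtain s where s: "0 < s" "cball z s \<subseteq> - ?B"
          using False by (meson ComplI open_contains_cball)
        define r where "r = min s \<rho>"
        have r: "(z, r) \<in> K" "cball z r \<subseteq> - ?B"
          using s z \<rho> by (auto simp: K_def r_def)
        obtain j where j: "j \<in> C" "\<not> disjnt (cball z r) (cball (fst j) (snd j))"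
            "cball z r \<subseteq> ball (fst j) (5 * snd j)"
          using cov[OF r(1)] by auto
        obtain n where n: "n \<in> I" "c n = j" using surj[OF j(1)] by auto
        have "\<not> n < N" using n j(2) r(2) by (auto simp: disjnt_def)
        moreover have "z \<in> cball z r" using r by (simp add: K_def)
        then have "z \<in> ball (fst (c n)) (5 * snd (c n))" using j(3) n(2) by blast
        ultimately have "z \<in> E n" using n(1) by (simp add: E_def)
        then show ?thesis by auto
      qed
    qed
    \<comment> \<open>An enlarged ball has diameter \<open>2 * 5 * snd (c n)\<close>, hence the
      hypothesis \<open>10 * \<rho> \<le> d\<close>.\<close>
    moreover have "bounded (E n) \<and> diameter (E n) \<le> d" for n
      using cK(2,3)[of n] \<rho> by (auto simp: E_def)
    ultimately have "E \<in> hausdorff_covers d Z"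
      by (simp add: hausdorff_covers_def)
    then have "hausdorff_content m d Z \<le> (\<Sum>n. hausdorff_size m (E n))"
      unfolding hausdorff_content_def by (rule INF_lower)
    \<comment> \<open>The tail is counted twice, once plain and once enlarged, which gives a series
      with a simple closed sum.\<close>
    also have "\<dots> \<le> (\<Sum>n. ennreal (w n + 5 ^ m * (w n - (if n \<in> {..<N} then w n else 0))))"
    proof (intro suminf_le)
      fix n
      show "hausdorff_size m (E n) \<le> ennreal (w n + 5 ^ m * (w n - (if n \<in> {..<N} then w n else 0)))"
      proof (cases "n \<in> I")
        case True
        show ?thesis
        proof (cases "n < N")
          case True
          then show ?thesis using \<open>n \<in> I\<close> cK(2)[of n] by (simp add: E_def hausdorff_size_cball w_def)
        next
          case False
          then have "hausdorff_size m (E n) = ennreal (5 ^ m * w n)"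
            using True cK(2)[of n] by (simp add: E_def hausdorff_size_cball w_def power_mult_distrib mult_ac)
          also have "\<dots> \<le> ennreal (w n + 5 ^ m * w n)" using w0 by (intro ennreal_leI) simp
          finally show ?thesis using False by simp
        qed
      qed (simp add: E_def hausdorff_size_def)
    qed auto
    also have "\<dots> = ennreal (T + 5 ^ m * (T - sum w {..<N}))"
    proof (rule suminf_ennreal_eq)
      show "(\<lambda>n. w n + 5 ^ m * (w n - (if n \<in> {..<N} then w n else 0))) sums (T + 5 ^ m * (T - sum w {..<N}))"
        by (intro sums_add sums_mult sums_diff T sums_If_finite_set) simp
    qed (use w0 in auto)
    also have "\<dots> \<le> ennreal (S + e)"
    proof (rule ennreal_leI)
      have "T - sum w {..<N} \<le> e / 5 ^ m" using N by auto
      then have "5 ^ m * (T - sum w {..<N}) \<le> e" by (simp add: field_simps)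
      then show "T + 5 ^ m * (T - sum w {..<N}) \<le> S + e" using TS by simp
    qed
    finally show "hausdorff_content m d Z \<le> ennreal S + ennreal e"
      using e \<open>0 \<le> S\<close> by (simp add: ennreal_plus)
  qed
qed

section \<open>Layers of a function with Lipschitz gradient around its regular zero set\<close>

locale regular_level_set =
  fixes f :: "real^'n \<Rightarrow> real" and G :: "real^'n \<Rightarrow> real^'n" and L R :: real
  assumes der: "\<And>x. (f has_derivative (\<lambda>h. G x \<bullet> h)) (at x)"
    and lip: "\<And>x y. norm (G x - G y) \<le> L * norm (x - y)"
    and reg: "\<And>x. f x = 0 \<Longrightarrow> G x \<noteq> 0"
    and inside: "\<And>x. f x = 0 \<Longrightarrow> norm x \<le> R"
    and R: "0 < R"
begin

definition "Z = {x. f x = 0}"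

text \<open>
  Excluding the zero set matches the junk value \<open>x / 0 = 0\<close> in the integrand and makes it unnecessary
  to know that \<open>Z\<close> is a null set.
\<close>

definition "layer s = density lborel (\<lambda>x. ennreal (norm (G x)) * indicator {x. 0 < \<bar>f x\<bar> \<and> \<bar>f x\<bar> \<le> s} x)"

lemma continuous_f: "continuous_on S f"
  by (intro continuous_at_imp_continuous_on ballI has_derivative_continuous[OF der])

lemma L_nonneg: "0 \<le> L"
proof -
  obtain b :: "real^'n" where "b \<in> Basis" using nonempty_Basis by blast
  then have "norm (G b - G 0) \<le> L" using lip[of b 0] by simp
  then show ?thesis by (rule order_trans[OF norm_ge_zero])
qed

lemma continuous_G: "continuous_on S G"
proof -
  have "L-lipschitz_on S G"
    using lip L_nonneg by (intro lipschitz_onI) (auto simp: dist_norm)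
  then show ?thesis by (rule lipschitz_on_continuous_on)
qed

lemma measurable_f [measurable]: "f \<in> borel_measurable borel"
  by (rule borel_measurable_continuous_onI[OF continuous_f])

lemma measurable_G [measurable]: "G \<in> borel_measurable borel"
  by (rule borel_measurable_continuous_onI[OF continuous_G])

lemma sets_slab [measurable]: "{x. 0 < \<bar>f x\<bar> \<and> \<bar>f x\<bar> \<le> s} \<in> sets borel"
proof -
  have "{x\<in>space borel. 0 < \<bar>f x\<bar> \<and> \<bar>f x\<bar> \<le> s} \<in> sets borel" by measurable
  then show ?thesis by simp
qed

lemma sets_layer [simp]: "sets (layer s) = sets borel"
  by (simp add: layer_def)

lemma emeasure_layer:
  assumes "A \<in> sets borel"
  shows "emeasure (layer s) A
    = (\<integral>\<^sup>+x. ennreal (norm (G x)) * indicator (A \<inter> {x. 0 < \<bar>f x\<bar> \<and> \<bar>f x\<bar> \<le> s}) x \<partial>lborel)"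
proof -
  have "(\<lambda>x. ennreal (norm (G x)) * indicator {x. 0 < \<bar>f x\<bar> \<and> \<bar>f x\<bar> \<le> s} x) \<in> borel_measurable lborel"
    using sets_slab by (intro borel_measurable_times_ennreal borel_measurable_indicator) auto
  then show ?thesis
    unfolding layer_def using assms
    by (simp add: emeasure_density indicator_inter_arith mult_ac)
qed

lemma compact_Z: "compact Z"
proof -
  have "closed Z"
    unfolding Z_def using continuous_f by (intro closed_Collect_eq) auto
  moreover have "bounded Z"
    using inside by (auto simp: bounded_iff Z_def)
  ultimately show ?thesis by (simp add: compact_eq_bounded_closed)
qed

text \<open>\<open>norm (G z)\<close> has a positive minimum on the compact set \<open>Z\<close>, so
  the Lipschitz bound turns into a relative error with one radius for all of \<open>Z\<close>.
  Dividing by \<open>L + 1\<close> covers the case \<open>L = 0\<close>.\<close>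

lemma gradient_nearly_constant:
  assumes "0 < \<epsilon>"
  obtains r where "0 < r" "\<And>z x. z \<in> Z \<Longrightarrow> x \<in> cball z r \<Longrightarrow> norm (G x - G z) \<le> \<epsilon> * norm (G z)"
proof (cases "Z = {}")
  case True
  then show thesis using that[of 1] by auto
next
  case False
  have "\<exists>z0\<in>Z. \<forall>z\<in>Z. norm (G z0) \<le> norm (G z)"
    by (rule continuous_attains_inf[OF compact_Z False]) (intro continuous_on_norm continuous_G)
  then obtain z0 where z0: "z0 \<in> Z" "\<And>z. z \<in> Z \<Longrightarrow> norm (G z0) \<le> norm (G z)"
    by auto
  have pos: "0 < norm (G z0)" using z0(1) reg by (simp add: Z_def)
  define r where "r = \<epsilon> * norm (G z0) / (L + 1)"
  have "0 < r" using pos assms L_nonneg by (simp add: r_def)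
  moreover have "norm (G x - G z) \<le> \<epsilon> * norm (G z)" if "z \<in> Z" "x \<in> cball z r" for z x
  proof -
    have "norm (G x - G z) \<le> L * norm (x - z)" by (rule lip)
    also have "\<dots> \<le> (L + 1) * r"
    proof (rule mult_mono)
      show "norm (x - z) \<le> r" using that(2) by (simp add: dist_norm norm_minus_commute)
    qed (use L_nonneg in simp_all)
    also have "\<dots> = \<epsilon> * norm (G z0)" using L_nonneg by (simp add: r_def)
    also have "\<dots> \<le> \<epsilon> * norm (G z)" using z0(2)[OF that(1)] assms by simp
    finally show ?thesis .
  qed
  ultimately show thesis by (rule that)
qed

lemma layer_le:
  assumes r: "\<And>x. x \<in> cball z r \<Longrightarrow> norm (G x - G z) \<le> \<epsilon> * norm (G z)" and z: "z \<in> Z"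
    and \<epsilon>: "0 \<le> \<epsilon>" "\<epsilon> < 1" and N: "N \<in> sets borel" "N \<subseteq> cball z r"
    and D: "0 < D" "\<And>x y. x \<in> N \<Longrightarrow> y \<in> N \<Longrightarrow> dist x y \<le> D" and s: "0 < s"
  shows "emeasure (layer s) N
    \<le> ennreal ((1 + \<epsilon>) / (1 - \<epsilon>) * (2 * s) * (unit_ball_vol (real (CARD('n) - 1)) * (D / 2) ^ (CARD('n) - 1)))"
  unfolding emeasure_layer[OF N(1)]
proof (rule layer_integral_le)
  show "G z \<noteq> 0" using z reg by (simp add: Z_def)
  show "convex (cball z r)" by (rule convex_cball)
qed (rule der measurable_f measurable_G | fact r \<epsilon> N D s)+

lemma layer_ge:
  assumes r: "0 < r" "\<And>x. x \<in> cball z r \<Longrightarrow> norm (G x - G z) \<le> \<epsilon> * norm (G z)" and z: "z \<in> Z"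
    and \<epsilon>: "0 < \<epsilon>" "\<epsilon> \<le> 1 / 2" and s: "0 < s" "s \<le> \<epsilon> * norm (G z) * (r / (1 + 4 * \<epsilon>))"
  shows "ennreal ((1 - \<epsilon>) / (1 + \<epsilon>) * (2 * s) *
      (unit_ball_vol (real (CARD('n) - 1)) * (r / (1 + 4 * \<epsilon>)) ^ (CARD('n) - 1)))
    \<le> emeasure (layer s) (cball z r)"
proof -
  have "cball z r \<in> sets borel" by simp
  show ?thesis
    unfolding emeasure_layer[OF \<open>cball z r \<in> sets borel\<close>]
  proof (rule layer_integral_ge)
    show "G z \<noteq> 0" "f z = 0" using z reg by (simp_all add: Z_def)
  qed (rule der measurable_f measurable_G | fact r \<epsilon> s)+
qed

text \<open>On the compact part of the ball outside the cover \<open>\<bar>f\<bar>\<close> has a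
  positive lower bound, so sufficiently thin layers lie inside the cover.\<close>

lemma layer_le_open_cover:
  assumes F: "finite F" "\<And>i. i \<in> F \<Longrightarrow> open (U i)" "Z \<subseteq> (\<Union>i\<in>F. U i)"
  obtains \<delta> where "0 < \<delta>"
    "\<And>s. s \<le> \<delta> \<Longrightarrow> emeasure (layer s) (cball 0 (2 * R)) \<le> (\<Sum>i\<in>F. emeasure (layer s) (U i))"
proof -
  let ?W = "\<Union>i\<in>F. U i" and ?B = "cball 0 (2 * R) :: (real^'n) set"
  have W: "open ?W" using F by (intro open_UN) auto
  have K: "compact (?B - ?W)" by (rule compact_diff[OF compact_cball W])
  obtain \<delta> where \<delta>: "0 < \<delta>" "\<And>x. x \<in> ?B - ?W \<Longrightarrow> \<delta> < \<bar>f x\<bar>"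
  proof (cases "?B - ?W = {}")
    case True
    show thesis by (rule that[of 1]) (use True in auto)
  next
    case False
    have "\<exists>x0\<in>?B - ?W. \<forall>x\<in>?B - ?W. \<bar>f x0\<bar> \<le> \<bar>f x\<bar>"
      by (rule continuous_attains_inf[OF K False]) (intro continuous_on_rabs continuous_f)
    then obtain x0 where x0: "x0 \<in> ?B - ?W" "\<And>x. x \<in> ?B - ?W \<Longrightarrow> \<bar>f x0\<bar> \<le> \<bar>f x\<bar>" by auto
    have "0 < \<bar>f x0\<bar>" using x0(1) F(3) by (auto simp: Z_def)
    then show thesis using x0(2) by (intro that[of "\<bar>f x0\<bar> / 2"]) force+
  qed
  show thesis
  proof (rule that[OF \<delta>(1)])
    fix s assume s: "s \<le> \<delta>"
    have sB: "?B \<in> sets borel" by simp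
    have sU: "U i \<in> sets borel" if "i \<in> F" for i using F(2)[OF that] by simp
    then have sW: "?W \<in> sets borel" using F(1) by (intro sets.finite_UN) auto
    have "emeasure (layer s) ?B \<le> emeasure (layer s) ?W"
      unfolding emeasure_layer[OF sB] emeasure_layer[OF sW]
    proof (intro nn_integral_mono mult_left_mono)
      fix x
      have "?B \<inter> {x. 0 < \<bar>f x\<bar> \<and> \<bar>f x\<bar> \<le> s} \<subseteq> ?W \<inter> {x. 0 < \<bar>f x\<bar> \<and> \<bar>f x\<bar> \<le> s}"
        using \<delta>(2) s by fastforce
      then show "indicator (?B \<inter> {x. 0 < \<bar>f x\<bar> \<and> \<bar>f x\<bar> \<le> s}) x
          \<le> (indicator (?W \<inter> {x. 0 < \<bar>f x\<bar> \<and> \<bar>f x\<bar> \<le> s}) x :: ennreal)"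
        by (auto simp: indicator_def)
    qed simp
    also have "\<dots> \<le> (\<Sum>i\<in>F. emeasure (layer s) (U i))"
      using sU F(1) by (intro emeasure_subadditive_finite) auto
    finally show "emeasure (layer s) ?B \<le> (\<Sum>i\<in>F. emeasure (layer s) (U i))" .
  qed
qed

section \<open>Comparison of the mass of thin layers with the Hausdorff measure\<close>

lemma layer_upper:
  assumes b: "hausdorff_measure (CARD('n) - 1) Z < ennreal b"
  obtains \<delta> where "0 < \<delta>"
    "\<And>s. 0 < s \<Longrightarrow> s \<le> \<delta> \<Longrightarrow> emeasure (layer s) (cball 0 (2 * R)) \<le> ennreal (2 * s * b)"
proof -
  define m where "m = CARD('n) - 1"
  let ?v = "unit_ball_vol (real m)"
  have v: "0 < ?v" by simp
  obtain h where h: "hausdorff_measure m Z = ennreal h" "0 \<le> h"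
    using b by (cases "hausdorff_measure m Z") (auto simp: m_def)
  have hb: "h < b" using b h by (simp add: m_def ennreal_less_iff)
  \<comment> \<open>The gap between \<open>h\<close> and \<open>b\<close> is spent twice:
    \<open>\<beta>\<close> leaves room for the cover and its enlargement, \<open>\<epsilon>\<close>
    for the variation of the gradient. The value of \<open>\<epsilon>\<close> solves
    \<open>(1 + \<epsilon>) / (1 - \<epsilon>) * \<beta> = b\<close>.\<close>
  define \<beta> where "\<beta> = (h + b) / 2"
  have \<beta>: "h < \<beta>" "\<beta> < b" "0 < \<beta>" using hb h(2) by (auto simp: \<beta>_def)
  define \<epsilon> where "\<epsilon> = (b - \<beta>) / (b + \<beta>)"
  have \<epsilon>: "0 < \<epsilon>" "\<epsilon> < 1" using \<beta> by (auto simp: \<epsilon>_def field_simps)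
  have "\<epsilon> * (b + \<beta>) = b - \<beta>" using \<beta> by (simp add: \<epsilon>_def)
  then have "(1 + \<epsilon>) * \<beta> = (1 - \<epsilon>) * b" by (simp add: algebra_simps)
  then have \<epsilon>\<beta>: "(1 + \<epsilon>) / (1 - \<epsilon>) * \<beta> = b" using \<epsilon> by (simp add: field_simps)
  obtain r where r: "0 < r" "\<And>z x. z \<in> Z \<Longrightarrow> x \<in> cball z r \<Longrightarrow> norm (G x - G z) \<le> \<epsilon> * norm (G z)"
    by (rule gradient_nearly_constant[OF \<epsilon>(1)]) (blast intro: that)
  have "hausdorff_content m (r / 2) Z \<le> hausdorff_measure m Z"
    unfolding hausdorff_measure_eq_SUP using r by (intro SUP_upper) simp
  also have "\<dots> < ennreal \<beta>" using h \<beta> by (simp add: ennreal_less_iff)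
  finally obtain E where E: "E \<in> hausdorff_covers (r / 2) Z" "(\<Sum>i. hausdorff_size m (E i)) < ennreal \<beta>"
    unfolding hausdorff_content_def by (auto simp: INF_less_iff)
  then obtain \<sigma> where \<sigma>: "(\<Sum>i. hausdorff_size m (E i)) = ennreal \<sigma>" "0 \<le> \<sigma>"
    by (cases "\<Sum>i. hausdorff_size m (E i)") auto
  define \<eta> where "\<eta> = \<beta> - \<sigma>"
  have \<eta>: "0 < \<eta>" using E(2) \<sigma> by (simp add: \<eta>_def ennreal_less_iff)
  have Eb: "bounded (E i)" "diameter (E i) \<le> r / 2" for i
    using E(1) by (auto simp: hausdorff_covers_def)
  have ZE: "Z \<subseteq> (\<Union>i. E i)" using E(1) by (auto simp: hausdorff_covers_def)
  have d0: "0 \<le> diameter (E i)" for i by (rule diameter_ge_0[OF Eb(1)])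
  \<comment> \<open>The covering sets are enlarged to open ones so that compactness yields a finite
    subcover. The costs \<open>\<eta> * (1 / 2) ^ Suc i\<close> add up to at most
    \<open>\<eta>\<close>. With cover diameters up to \<open>r / 2\<close> and
    \<open>e \<le> r / 4\<close>, the enlarged sets have diameter at most \<open>r\<close>, and
    \<open>0 < e\<close> makes \<open>D i\<close> positive even for a single point.\<close>
  have "\<exists>e>0. e \<le> r / 4 \<and> ?v * ((diameter (E i) + 2 * e) / 2) ^ m \<le> ?v * (diameter (E i) / 2) ^ m + \<eta> * (1 / 2) ^ Suc i"
    for i
  proof -
    have "((\<lambda>e. ?v * ((diameter (E i) + 2 * e) / 2) ^ m) \<longlongrightarrow> ?v * ((diameter (E i) + 2 * 0) / 2) ^ m) (at_right 0)"
      by (intro tendsto_intros) auto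
    then have "eventually (\<lambda>e. ?v * ((diameter (E i) + 2 * e) / 2) ^ m < ?v * (diameter (E i) / 2) ^ m + \<eta> * (1 / 2) ^ Suc i) (at_right 0)"
      using \<eta> by (intro order_tendstoD(2)) auto
    moreover have "eventually (\<lambda>e::real. 0 < e) (at_right 0)"
      by (rule eventually_at_right_less)
    moreover have "eventually (\<lambda>e::real. e < r / 4) (at_right 0)"
      using r by (intro order_tendstoD(2)[OF tendsto_ident_at]) auto
    ultimately have "eventually (\<lambda>e. 0 < e \<and> e \<le> r / 4 \<and> ?v * ((diameter (E i) + 2 * e) / 2) ^ m
        \<le> ?v * (diameter (E i) / 2) ^ m + \<eta> * (1 / 2) ^ Suc i) (at_right 0)"
      by eventually_elim simp
    then show ?thesis
      using eventually_happens'[OF trivial_limit_at_right_real] by blast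
  qed
  then obtain e where e: "\<And>i. 0 < e i" "\<And>i. e i \<le> r / 4"
    "\<And>i. ?v * ((diameter (E i) + 2 * e i) / 2) ^ m \<le> ?v * (diameter (E i) / 2) ^ m + \<eta> * (1 / 2) ^ Suc i"
    by metis
  define D where "D i = diameter (E i) + 2 * e i" for i
  define U where "U i = (\<Union>y\<in>E i. ball y (e i))" for i
  have D: "0 < D i" "D i \<le> r" for i
    using d0[of i] e(1,2)[of i] Eb(2)[of i] by (auto simp: D_def)
  have UD: "dist x y \<le> D i" if "x \<in> U i" "y \<in> U i" for x y i
  proof -
    obtain x' y' where xy: "x' \<in> E i" "dist x' x < e i" "y' \<in> E i" "dist y' y < e i"
      using \<open>x \<in> U i\<close> \<open>y \<in> U i\<close> by (auto simp: U_def)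
    have "dist x y \<le> dist x' x + dist x' y' + dist y' y"
      using dist_triangle[of x y x'] dist_triangle[of x' y y'] by (simp add: dist_commute)
    also have "dist x' y' \<le> diameter (E i)"
      by (rule diameter_bounded_bound[OF Eb(1) xy(1,3)])
    finally show ?thesis using xy by (simp add: D_def)
  qed
  have EU: "E i \<subseteq> U i" for i using e(1)[of i] by (auto simp: U_def)
  have oU: "open (U i)" for i unfolding U_def by (intro open_UN) auto
  \<comment> \<open>Sets that miss \<open>Z\<close> are discarded: a retained set provides a point
    of \<open>Z\<close> at which to freeze the gradient, and it is nonempty, so its Hausdorff size
    is given by the diameter formula.\<close>
  let ?J = "{i. E i \<inter> Z \<noteq> {}}"
  have "Z \<subseteq> (\<Union>i\<in>?J. U i)" using ZE EU by blast
  then obtain F where F: "F \<subseteq> ?J" "finite F" "Z \<subseteq> (\<Union>i\<in>F. U i)"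
    by (rule compactE_image[OF compact_Z oU]) (blast intro: that)
  obtain \<delta> where \<delta>: "0 < \<delta>"
    "\<And>s. s \<le> \<delta> \<Longrightarrow> emeasure (layer s) (cball 0 (2 * R)) \<le> (\<Sum>i\<in>F. emeasure (layer s) (U i))"
    by (rule layer_le_open_cover[OF F(2) oU F(3)]) (blast intro: that)
  have sumF: "(\<Sum>i\<in>F. ?v * (D i / 2) ^ m) \<le> \<beta>"
  proof -
    have "(\<Sum>i\<in>F. ennreal (?v * (diameter (E i) / 2) ^ m)) = (\<Sum>i\<in>F. hausdorff_size m (E i))"
      using F(1) by (intro sum.cong) (auto simp: hausdorff_size_def)
    also have "\<dots> \<le> (\<Sum>i. hausdorff_size m (E i))"
      by (rule sum_le_suminf) (auto simp: F(2))
    finally have "ennreal (\<Sum>i\<in>F. ?v * (diameter (E i) / 2) ^ m) \<le> ennreal \<sigma>"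
      using d0 \<sigma> by (simp add: sum_ennreal)
    then have 1: "(\<Sum>i\<in>F. ?v * (diameter (E i) / 2) ^ m) \<le> \<sigma>"
      using \<sigma>(2) by simp
    have "(\<Sum>i\<in>F. (1 / 2 :: real) ^ Suc i) \<le> (\<Sum>i. (1 / 2) ^ Suc i)"
      using power_half_series by (intro sum_le_suminf) (auto simp: F(2) sums_iff)
    then have 2: "(\<Sum>i\<in>F. (1 / 2 :: real) ^ Suc i) \<le> 1"
      using power_half_series by (simp add: sums_iff)
    have "(\<Sum>i\<in>F. ?v * (D i / 2) ^ m) \<le> (\<Sum>i\<in>F. ?v * (diameter (E i) / 2) ^ m + \<eta> * (1 / 2) ^ Suc i)"
      unfolding D_def by (intro sum_mono e(3))
    also have "\<dots> = (\<Sum>i\<in>F. ?v * (diameter (E i) / 2) ^ m) + \<eta> * (\<Sum>i\<in>F. (1 / 2) ^ Suc i)"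
      by (simp only: sum.distrib sum_distrib_left)
    also have "\<dots> \<le> \<sigma> + \<eta> * 1"
      using 1 2 \<eta> by (intro add_mono mult_left_mono) auto
    finally show ?thesis by (simp add: \<eta>_def)
  qed
  show thesis
  proof (rule that[OF \<delta>(1)])
    fix s :: real assume s: "0 < s" "s \<le> \<delta>"
    have c: "0 \<le> (1 + \<epsilon>) / (1 - \<epsilon>) * (2 * s)" using \<epsilon> s by simp
    have "emeasure (layer s) (cball 0 (2 * R)) \<le> (\<Sum>i\<in>F. emeasure (layer s) (U i))"
      by (rule \<delta>(2)[OF s(2)])
    also have "\<dots> \<le> (\<Sum>i\<in>F. ennreal ((1 + \<epsilon>) / (1 - \<epsilon>) * (2 * s) * (?v * (D i / 2) ^ m)))"
    proof (rule sum_mono)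
      fix i assume "i \<in> F"
      then obtain z where z: "z \<in> E i" "z \<in> Z" using F(1) by auto
      have "U i \<subseteq> cball z r"
      proof
        fix x assume "x \<in> U i"
        then have "dist z x \<le> D i" using z(1) EU by (intro UD) auto
        then show "x \<in> cball z r" using D(2)[of i] by simp
      qed
      then show "emeasure (layer s) (U i) \<le> ennreal ((1 + \<epsilon>) / (1 - \<epsilon>) * (2 * s) * (?v * (D i / 2) ^ m))"
        unfolding m_def using r(2)[OF z(2)] z(2) \<epsilon> oU D(1) UD s(1)
        by (intro layer_le[where z = z and r = r]) auto
    qed
    also have "\<dots> = ennreal ((1 + \<epsilon>) / (1 - \<epsilon>) * (2 * s) * (\<Sum>i\<in>F. ?v * (D i / 2) ^ m))"
    proof -
      have "0 \<le> (1 + \<epsilon>) / (1 - \<epsilon>) * (2 * s) * (?v * (D i / 2) ^ m)" for i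
        by (rule mult_nonneg_nonneg[OF c]) (use v D(1)[of i] in auto)
      then show ?thesis
        by (subst sum_ennreal) (simp_all only: sum_distrib_left)
    qed
    also have "\<dots> \<le> ennreal ((1 + \<epsilon>) / (1 - \<epsilon>) * (2 * s) * \<beta>)"
      using c by (intro ennreal_leI mult_left_mono sumF)
    also have "(1 + \<epsilon>) / (1 - \<epsilon>) * (2 * s) * \<beta> = 2 * s * ((1 + \<epsilon>) / (1 - \<epsilon>) * \<beta>)"
      by (simp only: mult_ac)
    finally show "emeasure (layer s) (cball 0 (2 * R)) \<le> ennreal (2 * s * b)"
      unfolding \<epsilon>\<beta> .
  qed
qed

text \<open>How thin a layer must be for \<open>layer_ge\<close> depends on the smallest ball of the
  family, so no thickness serves all disjoint families at once. Arguing by contradiction removes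
  this dependence: the negation supplies arbitrarily thin layers of small mass, each finite family
  gets its own, and the resulting bound \<open>a'\<close> on its sizes is the same for all
  families.\<close>

lemma layer_lower:
  assumes a: "0 \<le> a" "ennreal a < hausdorff_measure (CARD('n) - 1) Z"
  shows "\<exists>\<delta>>0. \<forall>s. 0 < s \<longrightarrow> s \<le> \<delta> \<longrightarrow> ennreal (2 * s * a) \<le> emeasure (layer s) (cball 0 (2 * R))"
proof (rule ccontr)
  assume "\<not> ?thesis"
  then have small: "\<exists>s>0. s \<le> \<delta> \<and> emeasure (layer s) (cball 0 (2 * R)) < ennreal (2 * s * a)"
    if "0 < \<delta>" for \<delta>
    using that by (meson not_le)
  define m where "m = CARD('n) - 1"
  let ?v = "unit_ball_vol (real m)" and ?B = "cball 0 (2 * R) :: (real^'n) set"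
  have v: "0 < ?v" by simp
  obtain d where d: "0 < d" "ennreal a < hausdorff_content m d Z"
    using a(2) unfolding hausdorff_measure_eq_SUP less_SUP_iff m_def by auto
  obtain y where y: "ennreal a < y" "y < hausdorff_content m d Z"
    using dense[OF d(2)] by auto
  then obtain a' where a': "y = ennreal a'" "0 \<le> a'" by (cases y) auto
  have aa': "a < a'" using y(1) a(1) a' by (simp add: ennreal_less_iff)
  \<comment> \<open>The factor next to \<open>a\<close> is the total loss in
    \<open>layer_ge\<close>, from the variation of the gradient and from the shrunken radius. It
    tends to 1, so a small \<open>\<epsilon>\<close> keeps the product below
    \<open>a'\<close>.\<close>
  have "((\<lambda>\<epsilon>. a * ((1 + \<epsilon>) * (1 + 4 * \<epsilon>) ^ m / (1 - \<epsilon>))) \<longlongrightarrow> a * ((1 + 0) * (1 + 4 * 0) ^ m / (1 - 0))) (at_right 0)"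
    by (intro tendsto_intros) auto
  then have "eventually (\<lambda>\<epsilon>. a * ((1 + \<epsilon>) * (1 + 4 * \<epsilon>) ^ m / (1 - \<epsilon>)) < a') (at_right 0)"
    using aa' by (intro order_tendstoD(2)) auto
  moreover have "eventually (\<lambda>\<epsilon>::real. 0 < \<epsilon>) (at_right 0)"
    by (rule eventually_at_right_less)
  moreover have "eventually (\<lambda>\<epsilon>::real. \<epsilon> < 1 / 2) (at_right 0)"
    by (intro order_tendstoD(2)[OF tendsto_ident_at]) auto
  ultimately have "eventually (\<lambda>\<epsilon>. a * ((1 + \<epsilon>) * (1 + 4 * \<epsilon>) ^ m / (1 - \<epsilon>)) < a' \<and> 0 < \<epsilon> \<and> \<epsilon> < 1 / 2) (at_right 0)"
    by eventually_elim simp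
  then obtain \<epsilon> where \<epsilon>: "a * ((1 + \<epsilon>) * (1 + 4 * \<epsilon>) ^ m / (1 - \<epsilon>)) < a'" "0 < \<epsilon>" "\<epsilon> < 1 / 2"
    using eventually_happens'[OF trivial_limit_at_right_real] by blast
  obtain r where r: "0 < r" "\<And>z x. z \<in> Z \<Longrightarrow> x \<in> cball z r \<Longrightarrow> norm (G x - G z) \<le> \<epsilon> * norm (G z)"
    by (rule gradient_nearly_constant[OF \<epsilon>(2)]) (blast intro: that)
  \<comment> \<open>\<open>r\<close> keeps the gradient nearly constant on each ball,
    \<open>d / 10\<close> makes fivefold enlargements admissible for the content at scale
    \<open>d\<close>, and \<open>R\<close> keeps balls centred in \<open>Z\<close> inside the ball
    of radius \<open>2 * R\<close>.\<close>
  define \<rho> where "\<rho> = min r (min (d / 10) R)"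
  have \<rho>: "0 < \<rho>" "10 * \<rho> \<le> d" "\<rho> \<le> r" "\<rho> \<le> R" using r(1) d(1) R by (auto simp: \<rho>_def)
  have "hausdorff_content m d Z \<le> ennreal a'"
  proof (rule hausdorff_content_le_disjoint_balls[OF \<rho>(1,2)])
    fix F :: "((real^'n) \<times> real) set"
    assume F: "finite F" "\<And>z t. (z, t) \<in> F \<Longrightarrow> z \<in> Z \<and> 0 < t \<and> t \<le> \<rho>"
      and disj: "pairwise (\<lambda>i j. disjnt (cball (fst i) (snd i)) (cball (fst j) (snd j))) F"
    have FK: "fst i \<in> Z" "0 < snd i" "snd i \<le> \<rho>" if "i \<in> F" for i
      using F(2)[of "fst i" "snd i"] that by simp_all
    define T where "T = (\<lambda>i. \<epsilon> * norm (G (fst i)) * (snd i / (1 + 4 * \<epsilon>))) ` F"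
    \<comment> \<open>The inserted 1 gives the minimum a meaning when the family is empty.\<close>
    define \<delta> where "\<delta> = Min (insert 1 T)"
    have fT: "finite (insert 1 T)" using F(1) by (simp add: T_def)
    have Tpos: "0 < t" if "t \<in> insert 1 T" for t
      using that FK(1,2) reg \<epsilon> by (auto simp: T_def Z_def intro!: mult_pos_pos divide_pos_pos)
    have "0 < \<delta>" unfolding \<delta>_def using Min_in[OF fT] by (intro Tpos) simp
    then obtain s where s: "0 < s" "s \<le> \<delta>" "emeasure (layer s) ?B < ennreal (2 * s * a)"
      using small by blast
    have s_le: "s \<le> \<epsilon> * norm (G (fst i)) * (snd i / (1 + 4 * \<epsilon>))" if "i \<in> F" for i
    proof -
      have "\<delta> \<le> \<epsilon> * norm (G (fst i)) * (snd i / (1 + 4 * \<epsilon>))"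
        unfolding \<delta>_def using that by (intro Min_le[OF fT]) (auto simp: T_def)
      then show ?thesis using s(2) by simp
    qed
    \<comment> \<open>\<open>\<kappa>\<close> is the layer mass that \<open>layer_ge\<close>
      guarantees per unit of Hausdorff size.\<close>
    define \<kappa> where "\<kappa> = (1 - \<epsilon>) / (1 + \<epsilon>) * (2 * s) / (1 + 4 * \<epsilon>) ^ m"
    have \<kappa>: "0 < \<kappa>" using \<epsilon> s(1) by (simp add: \<kappa>_def)
    let ?S = "\<Sum>i\<in>F. ?v * snd i ^ m"
    have "ennreal (\<kappa> * ?S) = (\<Sum>i\<in>F. ennreal (\<kappa> * (?v * snd i ^ m)))"
      using \<kappa> v FK(2) by (simp only: sum_distrib_left, subst sum_ennreal) (auto simp: less_imp_le)
    also have "\<dots> \<le> (\<Sum>i\<in>F. emeasure (layer s) (cball (fst i) (snd i)))"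
    proof (rule sum_mono)
      fix i assume i: "i \<in> F"
      have eq: "\<kappa> * (?v * snd i ^ m) = (1 - \<epsilon>) / (1 + \<epsilon>) * (2 * s) * (?v * (snd i / (1 + 4 * \<epsilon>)) ^ m)"
        by (simp add: \<kappa>_def power_divide)
      show "ennreal (\<kappa> * (?v * snd i ^ m)) \<le> emeasure (layer s) (cball (fst i) (snd i))"
        unfolding eq unfolding m_def
      proof (rule layer_ge)
        show "norm (G x - G (fst i)) \<le> \<epsilon> * norm (G (fst i))" if "x \<in> cball (fst i) (snd i)" for x
          using that FK(3)[OF i] \<rho>(3) by (intro r(2) FK(1)[OF i]) simp
      qed (use FK[OF i] \<epsilon> s_le[OF i] s(1) in auto)
    qed
    also have "\<dots> = emeasure (layer s) (\<Union>i\<in>F. cball (fst i) (snd i))"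
    proof (rule sum_emeasure)
      show "disjoint_family_on (\<lambda>i. cball (fst i) (snd i)) F"
        using disj unfolding disjoint_family_on_def pairwise_def disjnt_def by blast
    qed (auto simp: F(1))
    also have "\<dots> \<le> emeasure (layer s) ?B"
    proof (rule emeasure_mono)
      show "(\<Union>i\<in>F. cball (fst i) (snd i)) \<subseteq> ?B"
      proof
        fix x assume "x \<in> (\<Union>i\<in>F. cball (fst i) (snd i))"
        then obtain i where i: "i \<in> F" "dist (fst i) x \<le> snd i" by auto
        have "norm (fst i) \<le> R" using FK(1)[OF i(1)] inside by (simp add: Z_def)
        moreover have "norm x \<le> norm (fst i) + dist (fst i) x"
          using norm_triangle_sub[of x "fst i"] by (simp add: dist_norm norm_minus_commute)
        ultimately show "x \<in> ?B" using i(2) FK(3)[OF i(1)] \<rho>(4) by simp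
      qed
    qed simp
    also have "\<dots> < ennreal (2 * s * a)" by (rule s(3))
    finally have lt: "ennreal (\<kappa> * ?S) < ennreal (2 * s * a)" .
    have "\<kappa> * ?S \<le> 2 * s * a"
    proof (rule ccontr)
      assume "\<not> \<kappa> * ?S \<le> 2 * s * a"
      then have "ennreal (2 * s * a) \<le> ennreal (\<kappa> * ?S)" by (intro ennreal_leI) simp
      then show False using lt by (simp add: not_less[symmetric])
    qed
    then have "?S \<le> 2 * s * a / \<kappa>" using \<kappa> by (simp add: field_simps)
    also have "\<dots> = a * ((1 + \<epsilon>) * (1 + 4 * \<epsilon>) ^ m / (1 - \<epsilon>))"
      using \<epsilon> s(1) by (simp add: \<kappa>_def)
    also have "\<dots> \<le> a'" using \<epsilon>(1) by simp
    finally show "?S \<le> a'" .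
  qed
  then show False using y(2) a' by simp
qed

end

section \<open>The limit\<close>

text \<open>The fundamental theorem of calculus for \<open>- (s powr - p)\<close>. Integration stops
  at \<open>\<delta>\<close>, since layers are controlled only when thin; this leaves the boundary
  term \<open>\<delta> powr - p\<close>.\<close>

lemma powr_layer_cake:
  fixes u \<delta> p :: real
  assumes u: "0 < u" "u \<le> \<delta>" and p: "0 < p"
  shows "ennreal (u powr - p) = ennreal (\<delta> powr - p)
    + (\<integral>\<^sup>+s. ennreal (p * s powr (- p - 1)) * indicator {u..\<delta>} s \<partial>lborel)"
proof -
  have "(\<integral>\<^sup>+s. ennreal (p * s powr (- p - 1)) * indicator {u..\<delta>} s \<partial>lborel)
      = ennreal (- (\<delta> powr - p) - (- (u powr - p)))"
  proof (rule nn_integral_FTC_Icc)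
    show "(\<lambda>s. p * s powr (- p - 1)) \<in> borel_measurable borel" by measurable
    fix s assume s: "s \<in> {u..\<delta>}"
    then show "((\<lambda>s. - (s powr - p)) has_real_derivative p * s powr (- p - 1)) (at s)"
      using u by (auto intro!: derivative_eq_intros)
    show "0 \<le> p * s powr (- p - 1)" using p by simp
  qed (use u in auto)
  moreover have "\<delta> powr - p \<le> u powr - p"
    using u p by (intro powr_mono2') auto
  ultimately show ?thesis by (simp add: ennreal_plus[symmetric] del: ennreal_plus)
qed

text \<open>The model in which a layer of thickness \<open>s\<close> has mass
  \<open>2 * s * c\<close>; upper and lower bounds on layers are both evaluated by comparison with
  it. The condition \<open>p < 1\<close> makes the integral converge at 0, and the pole
  \<open>1 / (1 - p)\<close> is what the prefactor \<open>1 / k\<close> cancels.\<close>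

lemma powr_layer_value:
  fixes \<delta> p c :: real
  assumes \<delta>: "0 < \<delta>" and p: "0 < p" "p < 1" and c: "0 \<le> c"
  shows "ennreal (\<delta> powr - p) * ennreal (2 * \<delta> * c)
      + (\<integral>\<^sup>+s. ennreal (p * s powr (- p - 1)) * indicator {0<..\<delta>} s * ennreal (2 * s * c) \<partial>lborel)
    = ennreal (2 * c * \<delta> powr (1 - p) / (1 - p))"
proof -
  have "((\<lambda>s. s powr - p) has_integral (\<delta> powr (- p + 1) / (- p + 1))) {0..\<delta>}"
    using p \<delta> by (intro has_integral_powr_from_0) auto
  then have "((\<lambda>s. 2 * c * p * s powr - p) has_integral (2 * c * p * (\<delta> powr (- p + 1) / (- p + 1)))) {0..\<delta>}"
    by (rule has_integral_mult_right)
  then have i: "(\<integral>\<^sup>+s. ennreal (2 * c * p * s powr - p) * indicator {0..\<delta>} s \<partial>lborel)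
      = ennreal (2 * c * p * (\<delta> powr (- p + 1) / (- p + 1)))"
    using c p by (intro nn_integral_has_integral_lebesgue') auto
  have "(\<integral>\<^sup>+s. ennreal (p * s powr (- p - 1)) * indicator {0<..\<delta>} s * ennreal (2 * s * c) \<partial>lborel)
      = (\<integral>\<^sup>+s. ennreal (2 * c * p * s powr - p) * indicator {0..\<delta>} s \<partial>lborel)"
  proof (rule nn_integral_cong)
    fix s :: real
    show "ennreal (p * s powr (- p - 1)) * indicator {0<..\<delta>} s * ennreal (2 * s * c)
        = ennreal (2 * c * p * s powr - p) * indicator {0..\<delta>} s"
    proof (cases "0 < s \<and> s \<le> \<delta>")
      case True
      have "s powr - p = s * s powr (- p - 1)"
        using True powr_add[of s 1 "- p - 1"] by simp
      then have "p * s powr (- p - 1) * (2 * s * c) = 2 * c * p * s powr - p" by simp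
      then show ?thesis using True p c by (simp add: ennreal_mult[symmetric])
    next
      case False
      then have "s = 0 \<or> s \<notin> {0..\<delta>} \<and> s \<notin> {0<..\<delta>}" by auto
      then show ?thesis by auto
    qed
  qed
  also note i
  finally have "ennreal (\<delta> powr - p) * ennreal (2 * \<delta> * c)
      + (\<integral>\<^sup>+s. ennreal (p * s powr (- p - 1)) * indicator {0<..\<delta>} s * ennreal (2 * s * c) \<partial>lborel)
    = ennreal (\<delta> powr - p * (2 * \<delta> * c)) + ennreal (2 * c * p * (\<delta> powr (- p + 1) / (- p + 1)))"
    using c \<delta> by (simp add: ennreal_mult)
  also have "\<dots> = ennreal (\<delta> powr - p * (2 * \<delta> * c) + 2 * c * p * (\<delta> powr (- p + 1) / (- p + 1)))"
    using c \<delta> p by (intro ennreal_plus[symmetric]) auto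
  also have "\<delta> powr - p * (2 * \<delta> * c) = 2 * c * \<delta> powr (1 - p)"
    using \<delta> powr_add[of \<delta> 1 "- p"] by simp
  also have "2 * c * \<delta> powr (1 - p) + 2 * c * p * (\<delta> powr (- p + 1) / (- p + 1))
      = 2 * c * \<delta> powr (1 - p) / (1 - p)"
  proof -
    have "- p + 1 = 1 - p" by simp
    then show ?thesis using p by (simp add: field_simps)
  qed
  finally show ?thesis .
qed

context regular_level_set
begin

text \<open>Tonelli: for fixed \<open>s\<close> in \<open>{0<..\<delta>}\<close>, the condition
  \<open>\<bar>f x\<bar> \<le> s\<close> cuts the layer of thickness \<open>s\<close> out of the one
  of thickness \<open>\<delta>\<close>.\<close>

lemma nn_integral_powr_eq_layers:
  assumes \<delta>: "0 < \<delta>" and p: "0 < p" and A: "A \<in> sets borel"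
  shows "(\<integral>\<^sup>+x. ennreal (norm (G x)) * indicator (A \<inter> {x. 0 < \<bar>f x\<bar> \<and> \<bar>f x\<bar> \<le> \<delta>}) x
        * ennreal (\<bar>f x\<bar> powr - p) \<partial>lborel)
    = ennreal (\<delta> powr - p) * emeasure (layer \<delta>) A
      + (\<integral>\<^sup>+s. ennreal (p * s powr (- p - 1)) * indicator {0<..\<delta>} s * emeasure (layer s) A \<partial>lborel)"
proof -
  let ?S = "\<lambda>s. A \<inter> {x. 0 < \<bar>f x\<bar> \<and> \<bar>f x\<bar> \<le> s}"
  let ?q = "\<lambda>x. ennreal (norm (G x)) * indicator (?S \<delta>) x"
  let ?k = "\<lambda>s. ennreal (p * s powr (- p - 1))"
  have mq [measurable]: "?q \<in> borel_measurable borel"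
    using A sets_slab by (intro borel_measurable_times_ennreal borel_measurable_indicator sets.Int) auto
  have mk [measurable]: "?k \<in> borel_measurable borel" by measurable
  let ?J = "\<lambda>x s. ?k s * indicator {s. \<bar>f x\<bar> \<le> s \<and> s \<le> \<delta>} s"
  have mJ: "(\<lambda>s. ?J x s) \<in> borel_measurable borel" for x by measurable
  have mJ2: "(\<lambda>x. \<integral>\<^sup>+s. ?J x s \<partial>lborel) \<in> borel_measurable borel" by measurable
  have "(\<integral>\<^sup>+x. ?q x * ennreal (\<bar>f x\<bar> powr - p) \<partial>lborel)
      = (\<integral>\<^sup>+x. ennreal (\<delta> powr - p) * ?q x + ?q x * (\<integral>\<^sup>+s. ?J x s \<partial>lborel) \<partial>lborel)"
  proof (rule nn_integral_cong)
    fix x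
    show "?q x * ennreal (\<bar>f x\<bar> powr - p) = ennreal (\<delta> powr - p) * ?q x + ?q x * (\<integral>\<^sup>+s. ?J x s \<partial>lborel)"
    proof (cases "x \<in> ?S \<delta>")
      case True
      then have "ennreal (\<bar>f x\<bar> powr - p) = ennreal (\<delta> powr - p) + (\<integral>\<^sup>+s. ?J x s \<partial>lborel)"
        using powr_layer_cake[of "\<bar>f x\<bar>" \<delta> p] p by (simp add: atLeastAtMost_def atLeast_def atMost_def Collect_conj_eq)
      then show ?thesis by (simp only: distrib_left mult.commute)
    qed simp
  qed
  also have "\<dots> = (\<integral>\<^sup>+x. ennreal (\<delta> powr - p) * ?q x \<partial>lborel) + (\<integral>\<^sup>+x. ?q x * (\<integral>\<^sup>+s. ?J x s \<partial>lborel) \<partial>lborel)"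
    using mq mJ2 by (intro nn_integral_add) auto
  also have "(\<integral>\<^sup>+x. ennreal (\<delta> powr - p) * ?q x \<partial>lborel) = ennreal (\<delta> powr - p) * emeasure (layer \<delta>) A"
    unfolding emeasure_layer[OF A] using mq by (intro nn_integral_cmult) auto
  also have "(\<integral>\<^sup>+x. ?q x * (\<integral>\<^sup>+s. ?J x s \<partial>lborel) \<partial>lborel) = (\<integral>\<^sup>+x. \<integral>\<^sup>+s. ?q x * ?J x s \<partial>lborel \<partial>lborel)"
    using mJ by (intro nn_integral_cong nn_integral_cmult[symmetric]) auto
  also have "\<dots> = (\<integral>\<^sup>+s. \<integral>\<^sup>+x. ?q x * ?J x s \<partial>lborel \<partial>lborel)"
    by (rule lborel_pair.Fubini'[symmetric]) measurable
  also have "\<dots> = (\<integral>\<^sup>+s. ?k s * indicator {0<..\<delta>} s * emeasure (layer s) A \<partial>lborel)"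
  proof (rule nn_integral_cong)
    fix s :: real
    let ?qs = "\<lambda>x. ennreal (norm (G x)) * indicator (?S s) x"
    have mqs: "?qs \<in> borel_measurable borel"
      using A sets_slab by (intro borel_measurable_times_ennreal borel_measurable_indicator sets.Int) auto
    have "(\<integral>\<^sup>+x. ?q x * ?J x s \<partial>lborel) = (\<integral>\<^sup>+x. ?k s * indicator {0<..\<delta>} s * ?qs x \<partial>lborel)"
      by (intro nn_integral_cong) (auto simp: indicator_def mult_ac)
    also have "\<dots> = ?k s * indicator {0<..\<delta>} s * emeasure (layer s) A"
      unfolding emeasure_layer[OF A] using mqs by (intro nn_integral_cmult) auto
    finally show "(\<integral>\<^sup>+x. ?q x * ?J x s \<partial>lborel) = ?k s * indicator {0<..\<delta>} s * emeasure (layer s) A" .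
  qed
  finally show ?thesis .
qed

lemma nn_integral_powr_le:
  assumes \<delta>: "0 < \<delta>" and p: "0 < p" "p < 1" and A: "A \<in> sets borel" and b: "0 \<le> b"
    and le: "\<And>s. 0 < s \<Longrightarrow> s \<le> \<delta> \<Longrightarrow> emeasure (layer s) A \<le> ennreal (2 * s * b)"
  shows "(\<integral>\<^sup>+x. ennreal (norm (G x)) * indicator (A \<inter> {x. 0 < \<bar>f x\<bar> \<and> \<bar>f x\<bar> \<le> \<delta>}) x
        * ennreal (\<bar>f x\<bar> powr - p) \<partial>lborel) \<le> ennreal (2 * b * \<delta> powr (1 - p) / (1 - p))"
  unfolding nn_integral_powr_eq_layers[OF \<delta> p(1) A] powr_layer_value[OF \<delta> p b, symmetric]
proof (rule add_mono[OF mult_left_mono nn_integral_mono])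
  fix s
  show "ennreal (p * s powr (- p - 1)) * indicator {0<..\<delta>} s * emeasure (layer s) A
      \<le> ennreal (p * s powr (- p - 1)) * indicator {0<..\<delta>} s * ennreal (2 * s * b)"
    using le[of s] by (cases "s \<in> {0<..\<delta>}") (auto intro: mult_left_mono)
qed (use le \<delta> in auto)

lemma nn_integral_powr_ge:
  assumes \<delta>: "0 < \<delta>" and p: "0 < p" "p < 1" and A: "A \<in> sets borel" and a: "0 \<le> a"
    and ge: "\<And>s. 0 < s \<Longrightarrow> s \<le> \<delta> \<Longrightarrow> ennreal (2 * s * a) \<le> emeasure (layer s) A"
  shows "ennreal (2 * a * \<delta> powr (1 - p) / (1 - p))
    \<le> (\<integral>\<^sup>+x. ennreal (norm (G x)) * indicator (A \<inter> {x. 0 < \<bar>f x\<bar> \<and> \<bar>f x\<bar> \<le> \<delta>}) x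
        * ennreal (\<bar>f x\<bar> powr - p) \<partial>lborel)"
  unfolding nn_integral_powr_eq_layers[OF \<delta> p(1) A] powr_layer_value[OF \<delta> p a, symmetric]
proof (rule add_mono[OF mult_left_mono nn_integral_mono])
  fix s
  show "ennreal (p * s powr (- p - 1)) * indicator {0<..\<delta>} s * ennreal (2 * s * a)
      \<le> ennreal (p * s powr (- p - 1)) * indicator {0<..\<delta>} s * emeasure (layer s) A"
    using ge[of s] by (cases "s \<in> {0<..\<delta>}") (auto intro: mult_left_mono)
qed (use ge \<delta> in auto)

text \<open>By regularity \<open>\<bar>f x\<bar> + norm (G x)\<close> never vanishes, so it has a
  positive minimum \<open>\<mu>\<close> on the ball; where \<open>\<bar>f x\<bar>\<close> takes at
  most half of it, the gradient takes the other half.\<close>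

lemma gradient_bounds:
  obtains \<delta> c C where "0 < \<delta>" "0 < c" "1 \<le> C"
    "\<And>x. x \<in> cball 0 (2 * R) \<Longrightarrow> \<bar>f x\<bar> \<le> \<delta> \<Longrightarrow> c \<le> norm (G x)"
    "\<And>x. x \<in> cball 0 (2 * R) \<Longrightarrow> norm (G x) \<le> C"
proof -
  let ?B = "cball 0 (2 * R) :: (real^'n) set"
  have ne: "?B \<noteq> {}" using R by simp
  have "\<exists>x0\<in>?B. \<forall>x\<in>?B. \<bar>f x0\<bar> + norm (G x0) \<le> \<bar>f x\<bar> + norm (G x)"
    by (rule continuous_attains_inf[OF compact_cball ne])
      (intro continuous_on_add continuous_on_rabs continuous_on_norm continuous_f continuous_G)
  then obtain x0 where x0: "\<And>x. x \<in> ?B \<Longrightarrow> \<bar>f x0\<bar> + norm (G x0) \<le> \<bar>f x\<bar> + norm (G x)" by blast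
  have "\<exists>x1\<in>?B. \<forall>x\<in>?B. norm (G x) \<le> norm (G x1)"
    by (rule continuous_attains_sup[OF compact_cball ne]) (intro continuous_on_norm continuous_G)
  then obtain x1 where x1: "\<And>x. x \<in> ?B \<Longrightarrow> norm (G x) \<le> norm (G x1)" by blast
  define \<mu> where "\<mu> = \<bar>f x0\<bar> + norm (G x0)"
  have \<mu>: "0 < \<mu>"
  proof (cases "f x0 = 0")
    case True
    then show ?thesis using reg by (simp add: \<mu>_def)
  next
    case False
    then show ?thesis using norm_ge_zero[of "G x0"] by (simp add: \<mu>_def add_pos_nonneg)
  qed
  show thesis
  proof (rule that[of "\<mu> / 2" "\<mu> / 2" "max 1 (norm (G x1))"])
    show "\<mu> / 2 \<le> norm (G x)" if "x \<in> ?B" "\<bar>f x\<bar> \<le> \<mu> / 2" for x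
      using x0[OF that(1)] that(2) unfolding \<mu>_def[symmetric] by linarith
    show "norm (G x) \<le> max 1 (norm (G x1))" if "x \<in> ?B" for x
      using x1[OF that] by simp
  qed (use \<mu> in auto)
qed

section \<open>The sequence of the theorem, in terms of the gradient and Borel measure\<close>

definition "ratio_integral k = ennreal (1 / real k) *
  (\<integral>\<^sup>+x\<in>cball 0 (2 * R). ennreal ((norm (G x) / \<bar>f x\<bar>) powr ((real k - 1) / real k)) \<partial>lborel)"

text \<open>For \<open>k = 1\<close> the exponent is 0, outside the range of the layer formulas;
  hence the estimates start at 2.\<close>

lemma ratio_exponent:
  assumes "2 \<le> k"
  shows "0 < (real k - 1) / real k" "(real k - 1) / real k < 1" "1 - (real k - 1) / real k = 1 / real k"
  using assms by (auto simp: field_simps)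

text \<open>\<open>K\<close>, \<open>c\<close> and \<open>\<delta>\<close> do not depend on
  \<open>k\<close>, so that the limit can be taken afterwards with \<open>b\<close> fixed.\<close>

lemma ratio_integral_le:
  assumes b: "0 \<le> b" "hausdorff_measure (CARD('n) - 1) Z < ennreal b"
  shows "\<exists>K c \<delta>. 0 < c \<and> 0 < \<delta> \<and>
    (\<forall>k\<ge>2. ratio_integral k \<le> ennreal (1 / real k * K + 2 * b * (\<delta> / c) powr (1 / real k)))"
proof -
  let ?B = "cball 0 (2 * R) :: (real^'n) set"
  obtain \<delta>1 where \<delta>1: "0 < \<delta>1"
    "\<And>s. 0 < s \<Longrightarrow> s \<le> \<delta>1 \<Longrightarrow> emeasure (layer s) ?B \<le> ennreal (2 * s * b)"
    by (rule layer_upper[OF b(2)]) (blast intro: that)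
  obtain \<delta>2 c C where \<delta>2: "0 < \<delta>2" "0 < c" "1 \<le> C"
    and c: "\<And>x. x \<in> ?B \<Longrightarrow> \<bar>f x\<bar> \<le> \<delta>2 \<Longrightarrow> c \<le> norm (G x)"
    and C: "\<And>x. x \<in> ?B \<Longrightarrow> norm (G x) \<le> C"
    by (rule gradient_bounds) (blast intro: that)
  \<comment> \<open>With \<open>\<delta> \<le> 1 \<le> C\<close> the base
    \<open>C / \<delta>\<close> is at least 1, so its power \<open>p\<close> is at most
    \<open>C / \<delta>\<close> for every \<open>k\<close>.\<close>
  define \<delta> where "\<delta> = min 1 (min \<delta>1 \<delta>2)"
  have \<delta>: "0 < \<delta>" "\<delta> \<le> 1" "\<delta> \<le> \<delta>1" "\<delta> \<le> \<delta>2" using \<delta>1 \<delta>2 by (auto simp: \<delta>_def)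
  define V where "V = measure lborel ?B"
  have V: "emeasure lborel ?B = ennreal V" unfolding V_def
    by (intro emeasure_eq_ennreal_measure) (use R in \<open>simp add: emeasure_cball\<close>)
  have V0: "0 \<le> V" by (simp add: V_def)
  have "ratio_integral k \<le> ennreal (1 / real k * (C / \<delta> * V) + 2 * b * (\<delta> / c) powr (1 / real k))"
    if k: "2 \<le> k" for k
  proof -
    define p where "p = (real k - 1) / real k"
    define q where "q = 1 / real k"
    have p: "0 < p" "p < 1" "1 - p = q" using ratio_exponent[OF k] by (auto simp: p_def q_def)
    have q: "0 < q" using k by (simp add: q_def)
    have pq: "p = 1 + - q" using p(3) by simp
    let ?S = "?B \<inter> {x. 0 < \<bar>f x\<bar> \<and> \<bar>f x\<bar> \<le> \<delta>}"
    let ?h = "\<lambda>x. ennreal (norm (G x)) * indicator ?S x * ennreal (\<bar>f x\<bar> powr - p)"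
    have mh: "?h \<in> borel_measurable lborel"
      using sets_slab by (intro borel_measurable_times_ennreal borel_measurable_indicator sets.Int) auto
    have "(\<integral>\<^sup>+x\<in>?B. ennreal ((norm (G x) / \<bar>f x\<bar>) powr p) \<partial>lborel)
        \<le> (\<integral>\<^sup>+x. ennreal (C / \<delta>) * indicator ?B x + ennreal (c powr - q) * ?h x \<partial>lborel)"
    proof (rule nn_integral_mono)
      fix x
      show "ennreal ((norm (G x) / \<bar>f x\<bar>) powr p) * indicator ?B x
          \<le> ennreal (C / \<delta>) * indicator ?B x + ennreal (c powr - q) * ?h x"
      \<comment> \<open>At a zero of \<open>f\<close> the quotient is 0 by convention and
        \<open>0 powr p = 0\<close>, so the left side vanishes.\<close>
      proof (cases "x \<in> ?B \<and> f x \<noteq> 0")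
        case True
        show ?thesis
        proof (cases "\<bar>f x\<bar> \<le> \<delta>")
          case small: True
          have w: "c \<le> norm (G x)" using True small \<delta>(4) by (intro c) auto
          then have w0: "0 < norm (G x)" using \<delta>2(2) by linarith
          have "(norm (G x) / \<bar>f x\<bar>) powr p = norm (G x) powr p * \<bar>f x\<bar> powr - p"
            by (simp add: powr_divide powr_minus_divide)
          also have "norm (G x) powr p = norm (G x) * norm (G x) powr - q"
            using w0 unfolding pq powr_add by simp
          also have "\<dots> * \<bar>f x\<bar> powr - p \<le> norm (G x) * c powr - q * \<bar>f x\<bar> powr - p"
            using w \<delta>2(2) q by (intro mult_right_mono mult_left_mono powr_mono2') auto
          finally have "ennreal ((norm (G x) / \<bar>f x\<bar>) powr p)
              \<le> ennreal (c powr - q * (norm (G x) * \<bar>f x\<bar> powr - p))"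
            by (intro ennreal_leI) (simp only: mult_ac)
          also have "\<dots> = ennreal (c powr - q) * ?h x"
            using True small by (simp add: ennreal_mult)
          also have "\<dots> \<le> ennreal (C / \<delta>) * indicator ?B x + ennreal (c powr - q) * ?h x"
            by (rule add_increasing) simp_all
          finally show ?thesis using True by simp
        next
          case False
          have "norm (G x) / \<bar>f x\<bar> \<le> C / \<delta>"
            using True False C[of x] \<delta> \<delta>2(3) by (intro frac_le) auto
          then have "(norm (G x) / \<bar>f x\<bar>) powr p \<le> (C / \<delta>) powr p"
            using p by (intro powr_mono2) auto
          also have "\<dots> \<le> (C / \<delta>) powr 1"
            using p \<delta> \<delta>2(3) by (intro powr_mono) (auto simp: field_simps)
          also have "\<dots> = C / \<delta>" using \<delta> \<delta>2(3) by simp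
          finally have "ennreal ((norm (G x) / \<bar>f x\<bar>) powr p) \<le> ennreal (C / \<delta>)"
            by (rule ennreal_leI)
          then show ?thesis using True False by simp
        qed
      qed auto
    qed
    also have "\<dots> = ennreal (C / \<delta>) * emeasure lborel ?B + ennreal (c powr - q) * (\<integral>\<^sup>+x. ?h x \<partial>lborel)"
    proof -
      have 1: "(\<integral>\<^sup>+x. ennreal (c powr - q) * ?h x \<partial>lborel) = ennreal (c powr - q) * (\<integral>\<^sup>+x. ?h x \<partial>lborel)"
        by (rule nn_integral_cmult[OF mh])
      have 2: "(\<integral>\<^sup>+x. ennreal (C / \<delta>) * indicator ?B x \<partial>lborel) = ennreal (C / \<delta>) * emeasure lborel ?B"
        by (rule nn_integral_cmult_indicator) simp
      have "(\<lambda>x. ennreal (c powr - q) * ?h x) \<in> borel_measurable lborel"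
        by (intro borel_measurable_times_ennreal[OF _ mh]) simp
      moreover have "(\<lambda>x. ennreal (C / \<delta>) * indicator ?B x) \<in> borel_measurable lborel"
        by (intro borel_measurable_times_ennreal borel_measurable_indicator) simp_all
      ultimately show ?thesis
        unfolding 1[symmetric] 2[symmetric] by (intro nn_integral_add)
    qed
    also have "\<dots> \<le> ennreal (C / \<delta>) * emeasure lborel ?B + ennreal (c powr - q) * ennreal (2 * b * \<delta> powr (1 - p) / (1 - p))"
      using \<delta> p(1,2) b(1) \<delta>1(2) by (intro add_left_mono mult_left_mono nn_integral_powr_le) auto
    also have "\<dots> = ennreal (C / \<delta>) * ennreal V + ennreal (c powr - q) * ennreal (2 * b * \<delta> powr q / q)"
      by (simp only: V p(3))
    also have "\<dots> = ennreal (C / \<delta> * V) + ennreal (c powr - q * (2 * b * \<delta> powr q / q))"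
    proof -
      have "0 \<le> C / \<delta>" using \<delta>(1) \<delta>2(3) by simp
      then show ?thesis by (simp only: ennreal_mult'[of "C / \<delta>" V]
            ennreal_mult'[of "c powr - q" "2 * b * \<delta> powr q / q"] powr_ge_zero)
    qed
    also have "\<dots> = ennreal (C / \<delta> * V + c powr - q * (2 * b * \<delta> powr q / q))"
      using \<delta> \<delta>2(3) V0 b(1) q by (intro ennreal_plus[symmetric]) auto
    finally have "(\<integral>\<^sup>+x\<in>?B. ennreal ((norm (G x) / \<bar>f x\<bar>) powr p) \<partial>lborel)
        \<le> ennreal (C / \<delta> * V + c powr - q * (2 * b * \<delta> powr q / q))" .
    then have "ratio_integral k \<le> ennreal q * ennreal (C / \<delta> * V + c powr - q * (2 * b * \<delta> powr q / q))"
      unfolding ratio_integral_def p_def[symmetric] q_def[symmetric] by (rule mult_left_mono) simp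
    also have "\<dots> = ennreal (q * (C / \<delta> * V + c powr - q * (2 * b * \<delta> powr q / q)))"
      using q by (intro ennreal_mult'[symmetric]) simp
    also have "q * (C / \<delta> * V + c powr - q * (2 * b * \<delta> powr q / q)) = q * (C / \<delta> * V) + 2 * b * (\<delta> / c) powr q"
      using q \<delta> \<delta>2(2) by (simp add: powr_divide powr_minus_divide distrib_left)
    finally show ?thesis by (simp add: q_def)
  qed
  then show ?thesis using \<delta>2(2) \<delta>(1) by blast
qed

lemma ratio_integral_ge:
  assumes a: "0 \<le> a" "ennreal a < hausdorff_measure (CARD('n) - 1) Z"
  shows "\<exists>C \<delta>. 0 < C \<and> 0 < \<delta> \<and>
    (\<forall>k\<ge>2. ennreal (2 * a * (\<delta> / C) powr (1 / real k)) \<le> ratio_integral k)"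
proof -
  let ?B = "cball 0 (2 * R) :: (real^'n) set"
  obtain \<delta> where \<delta>: "0 < \<delta>"
    "\<And>s. 0 < s \<Longrightarrow> s \<le> \<delta> \<Longrightarrow> ennreal (2 * s * a) \<le> emeasure (layer s) ?B"
    using layer_lower[OF a] by auto
  obtain \<delta>2 c C where "0 < \<delta>2" "0 < c" and C1: "1 \<le> C"
    and "\<And>x. x \<in> ?B \<Longrightarrow> \<bar>f x\<bar> \<le> \<delta>2 \<Longrightarrow> c \<le> norm (G x)"
    and C: "\<And>x. x \<in> ?B \<Longrightarrow> norm (G x) \<le> C"
    by (rule gradient_bounds) (blast intro: that)
  have "ennreal (2 * a * (\<delta> / C) powr (1 / real k)) \<le> ratio_integral k" if k: "2 \<le> k" for k
  proof -
    define p where "p = (real k - 1) / real k"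
    define q where "q = 1 / real k"
    have p: "0 < p" "p < 1" "1 - p = q" using ratio_exponent[OF k] by (auto simp: p_def q_def)
    have q: "0 < q" using k by (simp add: q_def)
    have pq: "p = 1 + - q" using p(3) by simp
    let ?S = "?B \<inter> {x. 0 < \<bar>f x\<bar> \<and> \<bar>f x\<bar> \<le> \<delta>}"
    let ?h = "\<lambda>x. ennreal (norm (G x)) * indicator ?S x * ennreal (\<bar>f x\<bar> powr - p)"
    have mh: "?h \<in> borel_measurable lborel"
      using sets_slab by (intro borel_measurable_times_ennreal borel_measurable_indicator sets.Int) auto
    have "2 * a * (\<delta> / C) powr q = q * (C powr - q * (2 * a * \<delta> powr q / q))"
      using q \<delta> C1 by (simp add: powr_divide powr_minus_divide)
    then have "ennreal (2 * a * (\<delta> / C) powr q)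
        = ennreal (q * (C powr - q * (2 * a * \<delta> powr q / q)))"
      by (rule arg_cong)
    also have "\<dots> = ennreal q * ennreal (C powr - q * (2 * a * \<delta> powr q / q))"
      by (rule ennreal_mult'[OF less_imp_le[OF q]])
    also have "\<dots> = ennreal q * (ennreal (C powr - q) * ennreal (2 * a * \<delta> powr (1 - p) / (1 - p)))"
      by (simp only: p(3) ennreal_mult'[of "C powr - q"] powr_ge_zero)
    also have "\<dots> \<le> ennreal q * (ennreal (C powr - q) * (\<integral>\<^sup>+x. ?h x \<partial>lborel))"
      using \<delta> p(1,2) a(1) by (intro mult_left_mono nn_integral_powr_ge) auto
    also have "ennreal (C powr - q) * (\<integral>\<^sup>+x. ?h x \<partial>lborel) = (\<integral>\<^sup>+x. ennreal (C powr - q) * ?h x \<partial>lborel)"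
      by (rule nn_integral_cmult[OF mh, symmetric])
    also have "ennreal q * \<dots> \<le> ennreal q * (\<integral>\<^sup>+x\<in>?B. ennreal ((norm (G x) / \<bar>f x\<bar>) powr p) \<partial>lborel)"
    proof (rule mult_left_mono[OF nn_integral_mono])
      fix x
      show "ennreal (C powr - q) * ?h x \<le> ennreal ((norm (G x) / \<bar>f x\<bar>) powr p) * indicator ?B x"
      \<comment> \<open>Comparing negative powers requires \<open>norm (G x)\<close> to be positive;
        where \<open>G x = 0\<close>, the left side is 0.\<close>
      proof (cases "x \<in> ?S \<and> G x \<noteq> 0")
        case True
        then have w0: "0 < norm (G x)" by simp
        have "C powr - q * (norm (G x) * \<bar>f x\<bar> powr - p) \<le> norm (G x) powr - q * (norm (G x) * \<bar>f x\<bar> powr - p)"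
          using True w0 q C[of x] by (intro mult_right_mono powr_mono2') auto
        also have "\<dots> = norm (G x) powr p * \<bar>f x\<bar> powr - p"
          using w0 unfolding pq powr_add by simp
        also have "\<dots> = (norm (G x) / \<bar>f x\<bar>) powr p"
          by (simp add: powr_divide powr_minus_divide)
        finally have "ennreal (C powr - q * (norm (G x) * \<bar>f x\<bar> powr - p)) \<le> ennreal ((norm (G x) / \<bar>f x\<bar>) powr p)"
          by (rule ennreal_leI)
        then show ?thesis using True by (simp add: ennreal_mult)
      qed auto
    qed simp
    finally show ?thesis
      unfolding ratio_integral_def p_def[symmetric] q_def[symmetric] .
  qed
  then show ?thesis using C1 \<delta>(1) by (intro exI[of _ C] exI[of _ \<delta>]) auto
qed

lemma powr_inverse_nat_tendsto:
  fixes x :: real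
  assumes "0 < x"
  shows "(\<lambda>k. x powr (1 / real k)) \<longlonglongrightarrow> 1"
proof -
  have "(\<lambda>k. x powr (1 / real k)) \<longlonglongrightarrow> x powr 0"
    using assms by (intro tendsto_powr tendsto_const lim_1_over_n) simp
  then show ?thesis using assms by simp
qed

lemma ratio_integral_tendsto:
  "ratio_integral \<longlonglongrightarrow> 2 * hausdorff_measure (CARD('n) - 1) Z"
proof (rule order_tendstoI)
  let ?H = "hausdorff_measure (CARD('n) - 1) Z"
  fix l assume l: "l < 2 * ?H"
  then obtain t where t: "l = ennreal t" "0 \<le> t" by (cases l) auto
  \<comment> \<open>A real strictly between \<open>t / 2\<close> and the Hausdorff measure: the
    midpoint if the measure is finite, any large real if it is infinite. In the infinite case the
    upper half of the limit is vacuous.\<close>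
  have "\<exists>a\<ge>0. t < 2 * a \<and> ennreal a < ?H"
  proof (cases ?H)
    case (real h)
    then have "ennreal t < ennreal (2 * h)" using l t by (simp add: ennreal_mult)
    then have "t < 2 * h" using t by (simp add: ennreal_less_iff)
    then show ?thesis using real t
      by (intro exI[of _ "(t / 2 + h) / 2"]) (auto simp: ennreal_less_iff)
  next
    case top
    then show ?thesis using t by (intro exI[of _ "t + 1"]) auto
  qed
  then obtain a where a: "0 \<le> a" "t < 2 * a" "ennreal a < ?H" by auto
  obtain C \<delta> where C: "0 < C" "0 < \<delta>"
    "\<And>k. k \<ge> 2 \<Longrightarrow> ennreal (2 * a * (\<delta> / C) powr (1 / real k)) \<le> ratio_integral k"
    using ratio_integral_ge[OF a(1,3)] by auto
  have "(\<lambda>k. 2 * a * (\<delta> / C) powr (1 / real k)) \<longlonglongrightarrow> 2 * a * 1"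
    using C by (intro tendsto_mult tendsto_const powr_inverse_nat_tendsto) auto
  then have "eventually (\<lambda>k. t < 2 * a * (\<delta> / C) powr (1 / real k)) sequentially"
    using a(2) by (intro order_tendstoD(1)) auto
  then show "eventually (\<lambda>k. l < ratio_integral k) sequentially"
    using eventually_ge_at_top[of 2]
  proof eventually_elim
    case (elim k)
    then have "l < ennreal (2 * a * (\<delta> / C) powr (1 / real k))"
      using t by (simp add: ennreal_less_iff)
    then show ?case using C(3)[OF elim(2)] by (rule less_le_trans)
  qed
next
  let ?H = "hausdorff_measure (CARD('n) - 1) Z"
  fix u assume u: "2 * ?H < u"
  then obtain h where h: "?H = ennreal h" "0 \<le> h" by (cases ?H) (auto simp: ennreal_mult_eq_top_iff)
  have hu: "ennreal (2 * h) < u" using u h by (simp add: ennreal_mult)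
  obtain y where y: "ennreal (2 * h) < y" "y < u" using dense[OF hu] by auto
  then obtain t where t: "y = ennreal t" "0 \<le> t" by (cases y) auto
  have ht: "2 * h < t" using y(1) t h by (simp add: ennreal_less_iff)
  define b where "b = (h + t / 2) / 2"
  have b: "0 \<le> b" "?H < ennreal b" "2 * b < t" using ht h by (auto simp: b_def ennreal_less_iff)
  obtain K c \<delta> where c: "0 < c" "0 < \<delta>"
    "\<And>k. k \<ge> 2 \<Longrightarrow> ratio_integral k \<le> ennreal (1 / real k * K + 2 * b * (\<delta> / c) powr (1 / real k))"
    using ratio_integral_le[OF b(1,2)] by auto
  have "(\<lambda>k. 1 / real k * K + 2 * b * (\<delta> / c) powr (1 / real k)) \<longlonglongrightarrow> 0 * K + 2 * b * 1"
    using c by (intro tendsto_add tendsto_mult tendsto_const powr_inverse_nat_tendsto lim_1_over_n) auto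
  then have "eventually (\<lambda>k. 1 / real k * K + 2 * b * (\<delta> / c) powr (1 / real k) < t) sequentially"
    using b(3) by (intro order_tendstoD(2)) auto
  then show "eventually (\<lambda>k. ratio_integral k < u) sequentially"
    using eventually_ge_at_top[of 2]
  proof eventually_elim
    case (elim k)
    have "ratio_integral k \<le> ennreal (1 / real k * K + 2 * b * (\<delta> / c) powr (1 / real k))"
      by (rule c(3)[OF elim(2)])
    also have "\<dots> \<le> y" unfolding t(1) using elim(1) by (intro ennreal_leI) simp
    finally show ?case using y(2) by simp
  qed
qed

end

section \<open>From the derivative to the gradient\<close>

lemma onorm_inner: "onorm (\<lambda>h. a \<bullet> h) = norm a" for a :: "'a::euclidean_space"
proof (rule antisym)
  show "onorm (\<lambda>h. a \<bullet> h) \<le> norm a"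
    by (rule onorm_bound) (auto simp: Cauchy_Schwarz_ineq2)
  show "norm a \<le> onorm (\<lambda>h. a \<bullet> h)"
  proof (cases "a = 0")
    case False
    have "norm (a \<bullet> a) \<le> onorm (\<lambda>h. a \<bullet> h) * norm a"
      by (rule onorm) (rule bounded_linear_inner_right)
    then show ?thesis using False by (simp add: power2_norm_eq_inner[symmetric] power2_eq_square)
  qed (simp add: onorm_pos_le bounded_linear_inner_right)
qed

theorem theorem4p1:
  fixes f :: "real ^ 'n \<Rightarrow> real" and R :: real
  assumes "C11 f"
    and "R > 0"
    and "0 \<in> range f"
    and "regular_value f 0"
    and "f -` {0} \<subseteq> cball 0 R"
  shows "(\<lambda>k::nat. ennreal (1 / real k) *
            (\<integral>\<^sup>+x\<in>cball 0 (2 * R).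
               ennreal ((onorm (frechet_derivative f (at x)) / \<bar>f x\<bar>) powr ((real k - 1) / real k))
             \<partial>lebesgue))
         \<longlonglongrightarrow> 2 * hausdorff_measure (CARD('n) - 1) {x. f x = 0}"
proof -
  \<comment> \<open>The adjoint of a linear functional, applied to 1, is the vector that represents
    it.\<close>
  define G where "G x = adjoint (frechet_derivative f (at x)) 1" for x
  have works: "(f has_derivative frechet_derivative f (at x)) (at x)" for x
    using assms(1) by (simp add: C11_def frechet_derivative_works)
  have D: "frechet_derivative f (at x) = (\<lambda>h. G x \<bullet> h)" for x
  proof
    fix h
    have "linear (frechet_derivative f (at x))" by (rule has_derivative_linear[OF works])
    from adjoint_works[OF this, of h 1] show "frechet_derivative f (at x) h = G x \<bullet> h"
      by (simp add: G_def inner_commute)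
  qed
  obtain L where "\<And>v x. onorm (\<lambda>h. frechet_derivative f (at v) h - frechet_derivative f (at x) h) \<le> L * norm (v - x)"
    using assms(1) by (auto simp: C11_def)
  then have lip: "norm (G v - G x) \<le> L * norm (v - x)" for v x
    by (simp add: D inner_diff_left[symmetric] onorm_inner)
  interpret regular_level_set f G L R
  proof
    show "(f has_derivative (\<lambda>h. G x \<bullet> h)) (at x)" for x
      using works[of x] unfolding D .
    show "norm (G x - G y) \<le> L * norm (x - y)" for x y by (rule lip)
    show "G x \<noteq> 0" if "f x = 0" for x
    proof
      assume "G x = 0"
      moreover have "surj (frechet_derivative f (at x))"
        using assms(4) that by (simp add: regular_value_def)
      ultimately have "(1::real) \<in> range (\<lambda>h::real^'n. 0)" unfolding D by simp
      then show False by simp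
    qed
    show "norm x \<le> R" if "f x = 0" for x
      using assms(5) that by (auto simp: subset_eq)
  qed (rule assms(2))
  \<comment> \<open>The nonnegative integral does not change when the measure is completed, so the
    whole argument may run on Borel measure.\<close>
  have "(\<integral>\<^sup>+x\<in>cball 0 (2 * R). ennreal ((onorm (frechet_derivative f (at x)) / \<bar>f x\<bar>) powr ((real k - 1) / real k)) \<partial>lebesgue)
      = (\<integral>\<^sup>+x\<in>cball 0 (2 * R). ennreal ((norm (G x) / \<bar>f x\<bar>) powr ((real k - 1) / real k)) \<partial>lborel)" for k :: nat
    unfolding D onorm_inner by (rule nn_integral_completion)
  then show ?thesis
    using ratio_integral_tendsto by (simp add: ratio_integral_def[abs_def] Z_def)
qed

end
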